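(* Let $\Delta=\tilde\Psi-\tilde\Xi$ and $\tilde\Psi=\tilde\Phi-\tilde\Omega$ be the matrix and splittings associated, as described in the context, with a finite-horizon linear-quadratic optimal control problem over a $K\times N$ grid with horizon $T$. Let $S\in\mathbb{N}=\{1,2,\ldots\}$ and $L\in\{2,4,6,\ldots\}$, and set $$\tilde\Upsilon_L=\sum_{l=0}^{L-1}(\tilde\Phi^{-1}\tilde\Omega)^l\,\tilde\Phi^{-1},\qquad \varDelta_S=\sum_{s=0}^{S-1}(\tilde\Upsilon_L\tilde\Xi)^s\,\tilde\Upsilon_L .$$ Then $\varDelta_S$ is invertible and $P_S:=\varDelta_S^{-1}\succ 0$. Moreover, for every right-hand side $r\in\mathbb{R}^{\hat n(T+1)}$, the $S$-th iterate $\tilde\delta^{(S)}$ of the nested block Jacobi method (defined in the context) for $\Delta\tilde\delta=r$, with $L$ inner iterations per outer iteration, satisfies $$P_S\,\tilde\delta^{(S)}=r .$$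
   Context: **Conventions.** $A\succ0$ (resp. $A\succeq 0$) means that $A$ is real symmetric positive definite (resp. positive semi-definite). $A'$ denotes the transpose. $\mathrm{blkdiag}$ denotes a block diagonal matrix. **Problem data.** Let $K,N,T\in\mathbb{N}=\{1,2,\ldots\}$. For $1\le i\le K$, $1\le j\le N$ let $n_{i,j},m_{i,j}\in\mathbb{N}$. For $0\le t\le T$ let $Q_{i,j,t}\in\mathbb{R}^{n_{i,j}\times n_{i,j}}$ with $Q_{i,j,t}\succ0$. For $0\le t\le T-1$ let $R_{i,j,t}\in\mathbb{R}^{m_{i,j}\times m_{i,j}}$ with $R_{i,j,t}\succ0$, and let the following be arbitrary real matrices: $A_{i,j,t}\in\mathbb{R}^{n_{i,j}\times n_{i,j}}$, $B_{i,j,t}\in\mathbb{R}^{n_{i,j}\times m_{i,j}}$, $E_{i,j,t}\in\mathbb{R}^{n_{i,j}\times n_{i,j-1}}$ ($j\ge2$), $F_{i,j,t}\in\mathbb{R}^{n_{i,j}\times n_{i,j+1}}$ ($j\le N-1$), $G_{i,j,t}\in\mathbb{R}^{n_{i,j}\times n_{i-1,j}}$ ($i\ge2$), $H_{i,j,t}\in\mathbb{R}^{n_{i,j}\times n_{i+1,j}}$ ($i\le K-1$). These are the data of the problem of minimizing $\frac12\sum_{t,j,i}(x_{i,j,t}'Q_{i,j,t}x_{i,j,t}+u_{i,j,t}'R_{i,j,t}u_{i,j,t})$ (with no input term at $t=T$) subject to $x_{i,j,t+1}=A_{i,j,t}x_{i,j,t}+B_{i,j,t}u_{i,j,t}+E_{i,j,t}x_{i,j-1,t}+F_{i,j,t}x_{i,j+1,t}+G_{i,j,t}x_{i-1,j,t}+H_{i,j,t}x_{i+1,j,t}$,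 with given initial and spatial boundary values. The latter affect only the right-hand side of the linear system below. **Stacking vertically (over $i$).** Let $\bar n_j=\sum_{i=1}^K n_{i,j}$, $\bar Q_{j,t}=\mathrm{blkdiag}(Q_{1,j,t},\ldots,Q_{K,j,t})$, and define $\bar R_{j,t},\bar B_{j,t},\bar E_{j,t},\bar F_{j,t}$ likewise as block diagonal matrices. Let $\bar A_{j,t}$ be the block tri-diagonal matrix with diagonal blocks $A_{1,j,t},\ldots,A_{K,j,t}$, superdiagonal blocks $H_{1,j,t},\ldots,H_{K-1,j,t}$ and subdiagonal blocks $G_{2,j,t},\ldots,G_{K,j,t}$. **Stacking horizontally (over $j$).** Let $\hat n=\sum_{j=1}^N\bar n_j$, $\hat Q_t=\mathrm{blkdiag}(\bar Q_{1,t},\ldots,\bar Q_{N,t})$, and define $\hat R_t,\hat B_t$ likewise. Let $\hat A_t\in\mathbb{R}^{\hat n\times\hat n}$ be the block tri-diagonal matrix with diagonal blocks $\bar A_{1,t},\ldots,\bar A_{N,t}$, superdiagonal blocks $\bar F_{1,t},\ldots,\bar F_{N-1,t}$ and subdiagonal blocks $\bar E_{2,t},\ldots,\bar E_{N,t}$. **The matrix $\Delta$.** $\Delta\in\mathbb{R}^{\hat n(T+1)\times\hat n(T+1)}$ is the symmetric block tri-diagonal matrix, with blocks of size $\hat n\times\hat n$ indexed by $t=0,\ldots,T$, whose diagonal blocks are $\hat\Psi_0=\hat Q_0^{-1}$ and $$\hat\Psi_t=\hat Q_t^{-1}+\hat A_{t-1}\hat Q_{t-1}^{-1}\hat A_{t-1}'+\hat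 B_{t-1}\hat R_{t-1}^{-1}\hat B_{t-1}'\quad(1\le t\le T),$$ whose $(t+1,t)$ block is $-\hat A_t\hat Q_t^{-1}$ and whose $(t,t+1)$ block is $(-\hat A_t\hat Q_t^{-1})'$ for $0\le t\le T-1$. Equivalently, $\Delta=\tilde A\tilde Q^{-1}\tilde A'+\tilde B\tilde R^{-1}\tilde B'$, where $\tilde Q=\mathrm{blkdiag}(\hat Q_0,\ldots,\hat Q_T)$, $\tilde R=\mathrm{blkdiag}(\hat R_0,\ldots,\hat R_{T-1})$, $\tilde A$ is block lower bi-diagonal with diagonal blocks $-I$ and subdiagonal blocks $\hat A_0,\ldots,\hat A_{T-1}$, and $\tilde B$ has a zero first block row with $\mathrm{blkdiag}(\hat B_0,\ldots,\hat B_{T-1})$ beneath it. One has $\Delta\succ0$. **Outer splitting.** $\Delta=\tilde\Psi-\tilde\Xi$ with $\tilde\Psi=\mathrm{blkdiag}(\hat\Psi_0,\ldots,\hat\Psi_T)\succ0$ and $\tilde\Xi=\tilde\Psi-\Delta$. **Inner splitting.** Partition each $\hat\Psi_t\in\mathbb{R}^{\hat n\times\hat n}$ into $N\times N$ blocks according to $\hat n=\bar n_1+\cdots+\bar n_N$. With respect to this partition $\hat\Psi_t$ is block penta-diagonal. Group the block indices $1,\ldots,N$ into consecutive pairs $\{1,2\},\{3,4\},\ldots$, the last group being the singleton $\{N\}$ if $N$ is odd. This gives $V=\lceil N/2\rceil$ groups, and with respect to this coarser partition $\hat\Psi_t$ is block tri-diagonal. Let $\hat\Phi_t=\mathrm{blkdiag}(\bar\Phi_{1,t},\ldots,\bar\Phi_{V,t})$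 be the block diagonal part of $\hat\Psi_t$ with respect to this coarser $V\times V$ partition. Then $\tilde\Psi=\tilde\Phi-\tilde\Omega$ with $\tilde\Phi=\mathrm{blkdiag}(\hat\Phi_0,\ldots,\hat\Phi_T)\succ0$ and $\tilde\Omega=\tilde\Phi-\tilde\Psi$. **Nested block Jacobi method** for $\Delta\tilde\delta=r$ with $L$ inner iterations. Set $\tilde\delta^{(0)}=0$. For $s=0,1,\ldots,S-1$: put $r^{(s)}=r+\tilde\Xi\tilde\delta^{(s)}$ and $\tilde\theta^{(0)}=0$; for $l=0,\ldots,L-1$ let $\tilde\theta^{(l+1)}$ be the solution of $\tilde\Phi\tilde\theta^{(l+1)}=r^{(s)}+\tilde\Omega\tilde\theta^{(l)}$; then set $\tilde\delta^{(s+1)}=\tilde\theta^{(L)}$. *)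

theory Defs
  imports
    "Jordan_Normal_Form.Matrix"
    "Jordan_Normal_Form.Gauss_Jordan_Elimination"
begin

definition pos_def :: "real mat \<Rightarrow> bool" where
  "pos_def A \<longleftrightarrow> square_mat A \<and> transpose_mat A = A \<and>
     (\<forall>v \<in> carrier_vec (dim_row A). v \<noteq> 0\<^sub>v (dim_row A) \<longrightarrow> v \<bullet> (A *\<^sub>v v) > 0)"

text \<open>Meaningful for invertible matrices only, where \<^const>\<open>mat_inverse\<close> is not \<^const>\<open>None\<close>.\<close>

definition minv :: "real mat \<Rightarrow> real mat" where
  "minv A = the (mat_inverse A)"

definition mat_sum :: "nat \<Rightarrow> (nat \<Rightarrow> real mat) \<Rightarrow> nat \<Rightarrow> real mat" where
  "mat_sum n f k = mat n n (\<lambda>pq. \<Sum>l<k. f l $$ pq)"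

text \<open>
  A partition of the indices \<open>0, \<dots>, w 0 + \<dots> + w (k - 1) - 1\<close> into \<open>k\<close> consecutive blocks is
  given by the function \<open>w\<close> of block sizes.  Block \<open>a\<close> starts at \<open>offset w a\<close>, and
  \<open>block_index w p\<close> is the block that contains the index \<open>p\<close>.
\<close>

definition offset :: "(nat \<Rightarrow> nat) \<Rightarrow> nat \<Rightarrow> nat" where
  "offset w a = (\<Sum>i<a. w i)"

definition block_index :: "(nat \<Rightarrow> nat) \<Rightarrow> nat \<Rightarrow> nat" where
  "block_index w p = (LEAST a. p < offset w (Suc a))"

definition block_mat :: "nat \<Rightarrow> (nat \<Rightarrow> nat) \<Rightarrow> (nat \<Rightarrow> nat \<Rightarrow> real mat) \<Rightarrow> real mat" where
  "block_mat k w M = mat (offset w k) (offset w k) (\<lambda>(p, q).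
     let a = block_index w p; b = block_index w q
     in M a b $$ (p - offset w a, q - offset w b))"

text \<open>Row \<open>a\<close> of blocks contains \<open>Lo a\<close> (if \<open>a \<ge> 1\<close>), \<open>D a\<close> and \<open>Up a\<close> (if \<open>a + 1 < k\<close>).\<close>

definition block_tridiag ::
  "nat \<Rightarrow> (nat \<Rightarrow> nat) \<Rightarrow> (nat \<Rightarrow> real mat) \<Rightarrow> (nat \<Rightarrow> real mat) \<Rightarrow> (nat \<Rightarrow> real mat) \<Rightarrow> real mat" where
  "block_tridiag k w Lo D Up = block_mat k w (\<lambda>a b.
     if b = a then D a
     else if b = Suc a then Up a
     else if a = Suc b then Lo a
     else 0\<^sub>m (w a) (w b))"

definition blkdiag :: "nat \<Rightarrow> (nat \<Rightarrow> real mat) \<Rightarrow> real mat" where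
  "blkdiag k D = diag_block_mat (map D [0..<k])"

definition diag_block :: "(nat \<Rightarrow> nat) \<Rightarrow> real mat \<Rightarrow> nat \<Rightarrow> real mat" where
  "diag_block w M a = mat (w a) (w a) (\<lambda>(p, q). M $$ (offset w a + p, offset w a + q))"

text \<open>
  Spatial indices are counted from 0, so that \<open>(i, j)\<close> ranges over \<open>i < K\<close>, \<open>j < N\<close>;
  the time index runs from 0 to \<open>T\<close>.
  All data take their arguments in the order \<open>i\<close>, \<open>j\<close>, \<open>t\<close>.
\<close>

record lq_data =
  gK :: nat
  gN :: nat
  gT :: nat
  xdim :: "nat \<Rightarrow> nat \<Rightarrow> nat"
  udim :: "nat \<Rightarrow> nat \<Rightarrow> nat"
  Qm :: "nat \<Rightarrow> nat \<Rightarrow> nat \<Rightarrow> real mat"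
  Rm :: "nat \<Rightarrow> nat \<Rightarrow> nat \<Rightarrow> real mat"
  Am :: "nat \<Rightarrow> nat \<Rightarrow> nat \<Rightarrow> real mat"
  Bm :: "nat \<Rightarrow> nat \<Rightarrow> nat \<Rightarrow> real mat"
  Em :: "nat \<Rightarrow> nat \<Rightarrow> nat \<Rightarrow> real mat"
  Fm :: "nat \<Rightarrow> nat \<Rightarrow> nat \<Rightarrow> real mat"
  Gm :: "nat \<Rightarrow> nat \<Rightarrow> nat \<Rightarrow> real mat"
  Hm :: "nat \<Rightarrow> nat \<Rightarrow> nat \<Rightarrow> real mat"

definition lq_problem :: "lq_data \<Rightarrow> bool" where
  "lq_problem d \<longleftrightarrow>
     gK d \<ge> 1 \<and> gN d \<ge> 1 \<and> gT d \<ge> 1 \<and>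
     (\<forall>i < gK d. \<forall>j < gN d.
        xdim d i j \<ge> 1 \<and> udim d i j \<ge> 1 \<and>
        (\<forall>t \<le> gT d. Qm d i j t \<in> carrier_mat (xdim d i j) (xdim d i j) \<and> pos_def (Qm d i j t)) \<and>
        (\<forall>t < gT d.
           Rm d i j t \<in> carrier_mat (udim d i j) (udim d i j) \<and> pos_def (Rm d i j t) \<and>
           Am d i j t \<in> carrier_mat (xdim d i j) (xdim d i j) \<and>
           Bm d i j t \<in> carrier_mat (xdim d i j) (udim d i j) \<and>
           (j \<ge> 1 \<longrightarrow> Em d i j t \<in> carrier_mat (xdim d i j) (xdim d i (j - 1))) \<and>
           (j + 1 < gN d \<longrightarrow> Fm d i j t \<in> carrier_mat (xdim d i j) (xdim d i (j + 1))) \<and>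
           (i \<ge> 1 \<longrightarrow> Gm d i j t \<in> carrier_mat (xdim d i j) (xdim d (i - 1) j)) \<and>
           (i + 1 < gK d \<longrightarrow> Hm d i j t \<in> carrier_mat (xdim d i j) (xdim d (i + 1) j))))"

definition n_bar :: "lq_data \<Rightarrow> nat \<Rightarrow> nat" where
  "n_bar d j = (\<Sum>i<gK d. xdim d i j)"

definition Q_bar :: "lq_data \<Rightarrow> nat \<Rightarrow> nat \<Rightarrow> real mat" where
  "Q_bar d j t = blkdiag (gK d) (\<lambda>i. Qm d i j t)"

definition R_bar :: "lq_data \<Rightarrow> nat \<Rightarrow> nat \<Rightarrow> real mat" where
  "R_bar d j t = blkdiag (gK d) (\<lambda>i. Rm d i j t)"

definition B_bar :: "lq_data \<Rightarrow> nat \<Rightarrow> nat \<Rightarrow> real mat" where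
  "B_bar d j t = blkdiag (gK d) (\<lambda>i. Bm d i j t)"

definition E_bar :: "lq_data \<Rightarrow> nat \<Rightarrow> nat \<Rightarrow> real mat" where
  "E_bar d j t = blkdiag (gK d) (\<lambda>i. Em d i j t)"

definition F_bar :: "lq_data \<Rightarrow> nat \<Rightarrow> nat \<Rightarrow> real mat" where
  "F_bar d j t = blkdiag (gK d) (\<lambda>i. Fm d i j t)"

definition A_bar :: "lq_data \<Rightarrow> nat \<Rightarrow> nat \<Rightarrow> real mat" where
  "A_bar d j t = block_tridiag (gK d) (\<lambda>i. xdim d i j)
     (\<lambda>i. Gm d i j t) (\<lambda>i. Am d i j t) (\<lambda>i. Hm d i j t)"

definition n_hat :: "lq_data \<Rightarrow> nat" where
  "n_hat d = (\<Sum>j<gN d. n_bar d j)"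

definition Q_hat :: "lq_data \<Rightarrow> nat \<Rightarrow> real mat" where
  "Q_hat d t = blkdiag (gN d) (\<lambda>j. Q_bar d j t)"

definition R_hat :: "lq_data \<Rightarrow> nat \<Rightarrow> real mat" where
  "R_hat d t = blkdiag (gN d) (\<lambda>j. R_bar d j t)"

definition B_hat :: "lq_data \<Rightarrow> nat \<Rightarrow> real mat" where
  "B_hat d t = blkdiag (gN d) (\<lambda>j. B_bar d j t)"

definition A_hat :: "lq_data \<Rightarrow> nat \<Rightarrow> real mat" where
  "A_hat d t = block_tridiag (gN d) (n_bar d)
     (\<lambda>j. E_bar d j t) (\<lambda>j. A_bar d j t) (\<lambda>j. F_bar d j t)"

definition n_total :: "lq_data \<Rightarrow> nat" where
  "n_total d = n_hat d * (gT d + 1)"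

fun Psi_hat :: "lq_data \<Rightarrow> nat \<Rightarrow> real mat" where
  "Psi_hat d 0 = minv (Q_hat d 0)"
| "Psi_hat d (Suc t) = minv (Q_hat d (Suc t))
     + A_hat d t * minv (Q_hat d t) * transpose_mat (A_hat d t)
     + B_hat d t * minv (R_hat d t) * transpose_mat (B_hat d t)"

definition Delta :: "lq_data \<Rightarrow> real mat" where
  "Delta d = block_tridiag (gT d + 1) (\<lambda>_. n_hat d)
     (\<lambda>t. - (A_hat d (t - 1) * minv (Q_hat d (t - 1))))
     (Psi_hat d)
     (\<lambda>t. transpose_mat (- (A_hat d t * minv (Q_hat d t))))"

definition Psi :: "lq_data \<Rightarrow> real mat" where
  "Psi d = blkdiag (gT d + 1) (Psi_hat d)"

definition Xi :: "lq_data \<Rightarrow> real mat" where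
  "Xi d = Psi d - Delta d"

text \<open>The pairs \<open>{0, 1}, {2, 3}, \<dots>\<close> of column indices are the fibres of \<open>j div 2\<close>.\<close>

definition num_pairs :: "lq_data \<Rightarrow> nat" where
  "num_pairs d = (gN d + 1) div 2"

definition pair_dim :: "lq_data \<Rightarrow> nat \<Rightarrow> nat" where
  "pair_dim d v = (\<Sum>j\<in>{j. j < gN d \<and> j div 2 = v}. n_bar d j)"

definition Phi_hat :: "lq_data \<Rightarrow> nat \<Rightarrow> real mat" where
  "Phi_hat d t = blkdiag (num_pairs d) (diag_block (pair_dim d) (Psi_hat d t))"

definition Phi :: "lq_data \<Rightarrow> real mat" where
  "Phi d = blkdiag (gT d + 1) (Phi_hat d)"

definition Omega :: "lq_data \<Rightarrow> real mat" where
  "Omega d = Phi d - Psi d"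

definition lin_solution :: "real mat \<Rightarrow> real vec \<Rightarrow> real vec" where
  "lin_solution M b = (THE x. x \<in> carrier_vec (dim_col M) \<and> M *\<^sub>v x = b)"

primrec inner_iterate :: "lq_data \<Rightarrow> real vec \<Rightarrow> nat \<Rightarrow> real vec" where
  "inner_iterate d b 0 = 0\<^sub>v (n_total d)"
| "inner_iterate d b (Suc l) = lin_solution (Phi d) (b + Omega d *\<^sub>v inner_iterate d b l)"

primrec nested_jacobi :: "lq_data \<Rightarrow> nat \<Rightarrow> real vec \<Rightarrow> nat \<Rightarrow> real vec" where
  "nested_jacobi d L r 0 = 0\<^sub>v (n_total d)"
| "nested_jacobi d L r (Suc s) = inner_iterate d (r + Xi d *\<^sub>v nested_jacobi d L r s) L"

definition Upsilon :: "lq_data \<Rightarrow> nat \<Rightarrow> real mat" where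
  "Upsilon d L = mat_sum (n_total d)
     (\<lambda>l. (minv (Phi d) * Omega d) ^\<^sub>m l * minv (Phi d)) L"

definition varDelta :: "lq_data \<Rightarrow> nat \<Rightarrow> nat \<Rightarrow> real mat" where
  "varDelta d L S = mat_sum (n_total d)
     (\<lambda>s. (Upsilon d L * Xi d) ^\<^sub>m s * Upsilon d L) S"

end

theory Submission
  imports Defs "Jordan_Normal_Form.Determinant"
begin

text \<open>
  Let \<open>P\<close> and \<open>Z\<close> be symmetric with \<open>P\<close> and \<open>P + P Z P\<close> positive definite.  Then every partial sum
  of the Neumann series \<open>\<Sum>l. (P Z)^l P\<close> is positive definite, since consecutive terms pair up to
  congruences of \<open>P + P Z P\<close>.  Apply this first to \<open>P = \<Phi>\<^sup>-\<^sup>1\<close>, \<open>Z = \<Omega>\<close>, which gives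
  \<open>\<Upsilon>\<close>, and then to \<open>P = \<Upsilon>\<close>, \<open>Z = \<Xi>\<close>.  The first application needs that \<open>\<Phi> + \<Omega>\<close> is positive
  definite: it is \<open>J \<Psi> J\<close> for a diagonal sign matrix \<open>J\<close>.  The second one needs
  \<open>\<Upsilon> + \<Upsilon> \<Xi> \<Upsilon> = (\<Upsilon> - \<Upsilon> \<Psi> \<Upsilon>) + \<Upsilon> (\<Psi> + \<Xi>) \<Upsilon>\<close> to be positive definite: \<open>\<Psi> + \<Xi>\<close> is positive
  definite by completing squares, and for even \<open>L\<close> telescoping shows that \<open>\<Upsilon> - \<Upsilon> \<Psi> \<Upsilon>\<close> is a
  congruence of \<open>\<Upsilon>\<close> by \<open>(\<Phi>\<^sup>-\<^sup>1 \<Omega>)^(L/2)\<close>.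
\<close>

section \<open>Positive definite matrices\<close>

lemma pos_defI:
  assumes "A \<in> carrier_mat n n" "transpose_mat A = A"
    and "\<And>v. v \<in> carrier_vec n \<Longrightarrow> v \<noteq> 0\<^sub>v n \<Longrightarrow> 0 < v \<bullet> (A *\<^sub>v v)"
  shows "pos_def A"
  using assms by (auto simp: pos_def_def)

lemma pos_def_quad_pos:
  assumes "pos_def A" "A \<in> carrier_mat n n" "v \<in> carrier_vec n" "v \<noteq> 0\<^sub>v n"
  shows "0 < v \<bullet> (A *\<^sub>v v)"
  using assms by (auto simp: pos_def_def)

lemma pos_def_quad_nonneg:
  assumes "pos_def A" "A \<in> carrier_mat n n" "v \<in> carrier_vec n"
  shows "0 \<le> v \<bullet> (A *\<^sub>v v)"
proof (cases "v = 0\<^sub>v n")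
  case True
  with assms(2) have "A *\<^sub>v v \<in> carrier_vec n" by simp
  with True show ?thesis by simp
qed (use pos_def_quad_pos[OF assms] in auto)

lemma pos_def_quad_eq_0:
  assumes "pos_def A" "A \<in> carrier_mat n n" "v \<in> carrier_vec n" "v \<bullet> (A *\<^sub>v v) \<le> 0"
  shows "v = 0\<^sub>v n"
  using pos_def_quad_pos[OF assms(1-3)] assms(4) by force

lemma pos_def_sym: "pos_def A \<Longrightarrow> transpose_mat A = A"
  by (simp add: pos_def_def)

lemma scalar_prod_mult_mat_vec_left:
  fixes A :: "real mat"
  assumes "A \<in> carrier_mat n m" "v \<in> carrier_vec n" "w \<in> carrier_vec m"
  shows "v \<bullet> (A *\<^sub>v w) = (transpose_mat A *\<^sub>v v) \<bullet> w"
  using transpose_vec_mult_scalar[OF assms(1,3,2)] assms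
  by simp

text \<open>\<open>X\<close> may be rectangular because \<open>B_hat\<close> maps inputs to
  states.\<close>

lemma quad_congruence:
  fixes X M :: "real mat"
  assumes "X \<in> carrier_mat n m" "M \<in> carrier_mat m m" "v \<in> carrier_vec n"
  shows "v \<bullet> ((X * M * transpose_mat X) *\<^sub>v v) =
    (transpose_mat X *\<^sub>v v) \<bullet> (M *\<^sub>v (transpose_mat X *\<^sub>v v))"
proof -
  have X': "transpose_mat X \<in> carrier_mat m n" using assms by simp
  then have w: "transpose_mat X *\<^sub>v v \<in> carrier_vec m" using assms by simp
  have "(X * M * transpose_mat X) *\<^sub>v v = X *\<^sub>v (M *\<^sub>v (transpose_mat X *\<^sub>v v))"
    using assms X' w by (simp add: assoc_mult_mat_vec[of _ n m _ m] assoc_mult_mat_vec[of _ n m _ n])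
  moreover have "M *\<^sub>v (transpose_mat X *\<^sub>v v) \<in> carrier_vec m"
    using assms(2) w by simp
  ultimately show ?thesis
    using scalar_prod_mult_mat_vec_left[OF assms(1,3)] by simp
qed

lemma transpose_congruence:
  fixes X M :: "real mat"
  assumes "X \<in> carrier_mat n m" "M \<in> carrier_mat m m" "transpose_mat M = M"
  shows "transpose_mat (X * M * transpose_mat X) = X * M * transpose_mat X"
proof -
  have "transpose_mat (X * M * transpose_mat X) = X * transpose_mat (X * M)"
    using assms by (subst transpose_mult[of _ n m _ n]) auto
  also have "\<dots> = X * M * transpose_mat X"
    using assms transpose_mult[OF assms(1,2)] by simp
  finally show ?thesis .
qed

lemma quad_minus:
  fixes A B :: "real mat"
  assumes "A \<in> carrier_mat n n" "B \<in> carrier_mat n n" "v \<in> carrier_vec n"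
  shows "v \<bullet> ((A - B) *\<^sub>v v) = v \<bullet> (A *\<^sub>v v) - v \<bullet> (B *\<^sub>v v)"
  using assms by (simp add: minus_mult_distrib_mat_vec[OF assms] scalar_prod_minus_distrib[of _ n])

lemma quad_add:
  fixes A B :: "real mat"
  assumes "A \<in> carrier_mat n n" "B \<in> carrier_mat n n" "v \<in> carrier_vec n"
  shows "v \<bullet> ((A + B) *\<^sub>v v) = v \<bullet> (A *\<^sub>v v) + v \<bullet> (B *\<^sub>v v)"
  using assms by (simp add: add_mult_distrib_mat_vec[OF assms] scalar_prod_add_distrib[of _ n])

text \<open>A kernel vector would make the quadratic form vanish, so the determinant is nonzero and
  \<open>mat_inverse\<close> does return a matrix. Positivity of the inverse \<open>B\<close> comes
  from the substitution \<open>w = B v\<close>, under which v'Bv becomes w'Aw.\<close>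

lemma pos_def_minv:
  assumes "pos_def A" and A: "A \<in> carrier_mat n n"
  shows minv_carrier: "minv A \<in> carrier_mat n n"
    and minv_right: "A * minv A = 1\<^sub>m n"
    and minv_left: "minv A * A = 1\<^sub>m n"
    and pos_def_minv_pos_def: "pos_def (minv A)"
proof -
  have "det A \<noteq> 0"
  proof
    assume "det A = 0"
    then obtain v where v: "v \<in> carrier_vec n" "v \<noteq> 0\<^sub>v n" "A *\<^sub>v v = 0\<^sub>v n"
      using det_0_iff_vec_prod_zero_field[OF A] by blast
    with pos_def_quad_pos[OF assms v(1,2)] show False by simp
  qed
  \<comment> \<open>The unit value fills the free extra parameter of the matrix ring whose units
    both facts speak about.\<close>
  then have "mat_inverse A \<noteq> None"
    using mat_inverse(1)[OF A, of "()"] det_non_zero_imp_unit[OF A, of "()"] by blast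
  then obtain B where "mat_inverse A = Some B" by blast
  then have B: "minv A = B" "A * B = 1\<^sub>m n" "B * A = 1\<^sub>m n" "B \<in> carrier_mat n n"
    using mat_inverse(2)[OF A] by (auto simp: minv_def)
  then show "minv A \<in> carrier_mat n n" "A * minv A = 1\<^sub>m n" "minv A * A = 1\<^sub>m n" by auto
  have B': "transpose_mat B \<in> carrier_mat n n" using B by simp
  \<comment> \<open>By symmetry of \<open>A\<close>, the transpose of \<open>B\<close> is a left
    inverse of \<open>A\<close>, hence equal to the right inverse \<open>B\<close>.\<close>
  have "transpose_mat B * A = 1\<^sub>m n"
    using transpose_mult[OF A B(4)] B(2) pos_def_sym[OF assms(1)] by simp
  then have "transpose_mat B = transpose_mat B * (A * B)" using B B' by simp
  also have "\<dots> = (transpose_mat B * A) * B"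
    using assoc_mult_mat[OF B' A B(4)] by simp
  finally have sym: "transpose_mat B = B"
    using B \<open>transpose_mat B * A = 1\<^sub>m n\<close> by simp
  show "pos_def (minv A)" unfolding B(1)
  proof (rule pos_defI[OF B(4) sym])
    fix v :: "real vec" assume v: "v \<in> carrier_vec n" "v \<noteq> 0\<^sub>v n"
    define w where "w = B *\<^sub>v v"
    have w: "w \<in> carrier_vec n" using B v by (simp add: w_def)
    have Aw: "A *\<^sub>v w = v"
      using assoc_mult_mat_vec[OF A B(4) v(1)] B(2) v by (simp add: w_def)
    with v(2) A have "w \<noteq> 0\<^sub>v n" by auto
    then have "0 < w \<bullet> v" using pos_def_quad_pos[OF assms w] Aw by simp
    then show "0 < v \<bullet> (B *\<^sub>v v)"
      using comm_scalar_prod[OF w v(1)] by (simp add: w_def)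
  qed
qed

lemma pos_def_invertible:
  assumes "pos_def A" "A \<in> carrier_mat n n"
  shows "invertible_mat A"
  using assms minv_right[OF assms] minv_left[OF assms] minv_carrier[OF assms]
  unfolding invertible_mat_def inverts_mat_def by auto

lemma transpose_minus_sym:
  fixes A B :: "real mat"
  assumes "A \<in> carrier_mat n n" "B \<in> carrier_mat n n" "transpose_mat A = A" "transpose_mat B = B"
  shows "transpose_mat (A - B) = A - B"
  using transpose_minus[OF assms(1,2)] assms(3,4) by simp

lemma zero_mult_vec:
  assumes "(b :: real vec) \<in> carrier_vec n"
  shows "0\<^sub>m n n *\<^sub>v b = 0\<^sub>v n"
  using assms by (intro eq_vecI) auto

section \<open>Sums and powers of matrices\<close>

lemma mat_sum_carrier [simp]: "mat_sum n f k \<in> carrier_mat n n"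
  by (simp add: mat_sum_def)

lemma mat_sum_0: "mat_sum n f 0 = 0\<^sub>m n n"
  by (rule eq_matI) (auto simp: mat_sum_def)

lemma mat_sum_Suc: "f k \<in> carrier_mat n n \<Longrightarrow> mat_sum n f (Suc k) = mat_sum n f k + f k"
  by (rule eq_matI) (auto simp: mat_sum_def)

text \<open>Matrix powers unfold with the new factor on the right; the series also needs it on the
  left.\<close>

lemma pow_mat_Suc_left:
  assumes "(A :: 'a :: semiring_1 mat) \<in> carrier_mat n n"
  shows "A ^\<^sub>m Suc k = A * A ^\<^sub>m k"
proof (induction k)
  case (Suc k)
  have "A ^\<^sub>m Suc (Suc k) = (A * A ^\<^sub>m k) * A"
    using Suc by simp
  also have "\<dots> = A * A ^\<^sub>m Suc k"
    using assms assoc_mult_mat[OF assms pow_carrier_mat[OF assms] assms] by simp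
  finally show ?case .
qed (use assms in simp)

lemma pow_mat_add:
  assumes "(A :: 'a :: semiring_1 mat) \<in> carrier_mat n n"
  shows "A ^\<^sub>m (j + k) = A ^\<^sub>m j * A ^\<^sub>m k"
proof (induction k)
  case (Suc k)
  then show ?case
    using assoc_mult_mat[OF pow_carrier_mat[OF assms] pow_carrier_mat[OF assms] assms, of j k] by simp
qed (use assms in simp)

lemma transpose_pow:
  fixes A :: "real mat"
  assumes "A \<in> carrier_mat n n"
  shows "transpose_mat (A ^\<^sub>m k) = transpose_mat A ^\<^sub>m k"
proof (induction k)
  case 0
  then show ?case using assms by simp
next
  case (Suc k)
  have "A ^\<^sub>m Suc k = A * A ^\<^sub>m k" by (rule pow_mat_Suc_left[OF assms])
  then show ?case using Suc transpose_mult[OF assms, of "A ^\<^sub>m k" n] assms by simp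
qed

section \<open>Partial sums of a Neumann series\<close>

context
  fixes n :: nat and P Z :: "real mat"
  assumes P: "P \<in> carrier_mat n n" and Z: "Z \<in> carrier_mat n n"
    and symP: "transpose_mat P = P" and symZ: "transpose_mat Z = Z"
begin

lemma PZ_carrier: "P * Z \<in> carrier_mat n n" "Z * P \<in> carrier_mat n n"
  using P Z by auto

lemma PZ_pow_carrier: "(P * Z) ^\<^sub>m k \<in> carrier_mat n n" "(Z * P) ^\<^sub>m k \<in> carrier_mat n n"
  using PZ_carrier by auto

lemma term_carrier: "(P * Z) ^\<^sub>m k * P \<in> carrier_mat n n"
  using PZ_pow_carrier P by auto

lemma transpose_PZ: "transpose_mat (P * Z) = Z * P"
  using transpose_mult[OF P Z] symP symZ by simp

text \<open>Both sides are the alternating word P Z P ... Z P with \<open>k\<close> factors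
  \<open>Z\<close>. The word is a palindrome in symmetric letters, which is why each term of the
  series is symmetric.\<close>

lemma pow_mult_shift: "(P * Z) ^\<^sub>m k * P = P * (Z * P) ^\<^sub>m k"
proof (induction k)
  case 0
  then show ?case using P Z by simp
next
  case (Suc k)
  have "(P * Z) ^\<^sub>m Suc k * P = (P * Z) ^\<^sub>m k * (P * (Z * P))"
    using PZ_pow_carrier(1)[of k] P Z PZ_carrier
    by (simp add: assoc_mult_mat[of _ n n _ n _ n])
  also have "\<dots> = (P * Z) ^\<^sub>m k * P * (Z * P)"
    using assoc_mult_mat[OF PZ_pow_carrier(1)[of k] P PZ_carrier(2)] by simp
  also have "\<dots> = P * (Z * P) ^\<^sub>m Suc k"
    using assoc_mult_mat[OF P PZ_pow_carrier(2)[of k] PZ_carrier(2)] by (simp add: Suc)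
  finally show ?case .
qed

lemma term_sym: "transpose_mat ((P * Z) ^\<^sub>m k * P) = (P * Z) ^\<^sub>m k * P"
  using transpose_mult[OF PZ_pow_carrier(1) P, of k] transpose_pow[OF PZ_carrier(1), of k]
  by (simp add: symP transpose_PZ pow_mult_shift)

abbreviation partial_sum :: "nat \<Rightarrow> real mat" where
  "partial_sum \<equiv> mat_sum n (\<lambda>k. (P * Z) ^\<^sub>m k * P)"

lemma partial_sum_Suc: "partial_sum (Suc k) = partial_sum k + (P * Z) ^\<^sub>m k * P"
  by (rule mat_sum_Suc) (rule term_carrier)

lemma term_Suc: "(P * Z) ^\<^sub>m Suc k * P = P * Z * ((P * Z) ^\<^sub>m k * P)"
  unfolding pow_mat_Suc_left[OF PZ_carrier(1)]
  by (rule assoc_mult_mat[OF PZ_carrier(1) PZ_pow_carrier(1) P])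

text \<open>Both sides are the term with index \<open>k + 1\<close>; the new factors can be attached
  at either end.\<close>

lemma term_comm: "P * Z * ((P * Z) ^\<^sub>m k * P) = (P * Z) ^\<^sub>m k * P * (Z * P)"
proof -
  have "P * Z * ((P * Z) ^\<^sub>m k * P) = (P * Z) ^\<^sub>m k * (P * Z) * P"
    using term_Suc[of k] by simp
  also have "\<dots> = (P * Z) ^\<^sub>m k * (P * (Z * P))"
    using assoc_mult_mat[OF PZ_pow_carrier(1)[of k] PZ_carrier(1) P] assoc_mult_mat[OF P Z P]
    by simp
  also have "\<dots> = (P * Z) ^\<^sub>m k * P * (Z * P)"
    using assoc_mult_mat[OF PZ_pow_carrier(1)[of k] P PZ_carrier(2)] by simp
  finally show ?thesis .
qed

lemma partial_sum_comm: "P * Z * partial_sum k = partial_sum k * (Z * P)"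
proof (induction k)
  case 0
  then show ?case using P Z by (simp add: mat_sum_0)
next
  case (Suc k)
  show ?case
    unfolding partial_sum_Suc mult_add_distrib_mat[OF PZ_carrier(1) mat_sum_carrier term_carrier]
      add_mult_distrib_mat[OF mat_sum_carrier term_carrier PZ_carrier(2)] Suc term_comm ..
qed

text \<open>Horner form of the sum: adding a term at the top is the same as multiplying by
  \<open>P * Z\<close> and adding \<open>P\<close> at the bottom.\<close>

lemma partial_sum_rec: "partial_sum (Suc k) = P + P * Z * partial_sum k"
proof (induction k)
  case 0
  then show ?case using P Z partial_sum_Suc[of 0] by (simp add: mat_sum_0)
next
  case (Suc k)
  have "partial_sum (Suc (Suc k)) = P + P * Z * partial_sum k + P * Z * ((P * Z) ^\<^sub>m k * P)"
    unfolding partial_sum_Suc[of "Suc k"] Suc term_Suc ..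
  also have "\<dots> = P + (P * Z * partial_sum k + P * Z * ((P * Z) ^\<^sub>m k * P))"
    by (rule assoc_add_mat[OF P mult_carrier_mat[OF PZ_carrier(1) mat_sum_carrier]
      mult_carrier_mat[OF PZ_carrier(1) term_carrier]])
  also have "\<dots> = P + P * Z * partial_sum (Suc k)"
    unfolding partial_sum_Suc[of k] mult_add_distrib_mat[OF PZ_carrier(1) mat_sum_carrier term_carrier] ..
  finally show ?case .
qed

text \<open>This is one Jacobi step with right-hand side \<open>b\<close>. It serves the inner loop
  with \<open>P\<close> the inverse of \<Phi> and \<open>Z\<close> = \<Omega>, and the outer loop
  with \<open>P\<close> = \<Upsilon> and \<open>Z\<close> = \<Xi>.\<close>

lemma partial_sum_rec_vec:
  assumes b: "b \<in> carrier_vec n"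
  shows "partial_sum (Suc k) *\<^sub>v b = P *\<^sub>v (b + Z *\<^sub>v (partial_sum k *\<^sub>v b))"
proof -
  have c: "partial_sum k *\<^sub>v b \<in> carrier_vec n" using b mult_mat_vec_carrier[OF mat_sum_carrier b] by blast
  have "partial_sum (Suc k) *\<^sub>v b = P *\<^sub>v b + P * Z * partial_sum k *\<^sub>v b"
    unfolding partial_sum_rec
    by (rule add_mult_distrib_mat_vec[OF P mult_carrier_mat[OF PZ_carrier(1) mat_sum_carrier] b])
  also have "P * Z * partial_sum k *\<^sub>v b = P *\<^sub>v (Z *\<^sub>v (partial_sum k *\<^sub>v b))"
    using assoc_mult_mat_vec[OF PZ_carrier(1) mat_sum_carrier b] assoc_mult_mat_vec[OF P Z c] by simp
  also have "P *\<^sub>v b + \<dots> = P *\<^sub>v (b + Z *\<^sub>v (partial_sum k *\<^sub>v b))"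
    using mult_add_distrib_mat_vec[OF P b mult_mat_vec_carrier[OF Z c]] by simp
  finally show ?thesis .
qed

lemma partial_sum_sym: "transpose_mat (partial_sum k) = partial_sum k"
proof (induction k)
  case (Suc k)
  then show ?case
    unfolding partial_sum_Suc using transpose_add[OF mat_sum_carrier term_carrier] term_sym by simp
qed (simp add: mat_sum_0)

text \<open>The term with index \<open>k + 2\<close> is the term with index \<open>k\<close> with
  \<open>P * Z\<close> multiplied on the left and its transpose on the right.\<close>

lemma quad_term_add_2:
  assumes x: "x \<in> carrier_vec n"
  shows "x \<bullet> ((P * Z) ^\<^sub>m Suc (Suc k) * P *\<^sub>v x) =
    (Z * P *\<^sub>v x) \<bullet> ((P * Z) ^\<^sub>m k * P *\<^sub>v (Z * P *\<^sub>v x))"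
proof -
  have "(P * Z) ^\<^sub>m Suc (Suc k) * P = P * Z * ((P * Z) ^\<^sub>m k * P * (Z * P))"
    unfolding term_Suc[of "Suc k"] term_Suc[of k] term_comm[of k] ..
  also have "\<dots> = P * Z * ((P * Z) ^\<^sub>m k * P) * transpose_mat (P * Z)"
    unfolding transpose_PZ
    by (rule assoc_mult_mat[OF PZ_carrier(1) term_carrier PZ_carrier(2), symmetric])
  finally show ?thesis
    using quad_congruence[OF PZ_carrier(1) term_carrier x] by (simp add: transpose_PZ)
qed

lemma quad_partial_sum:
  assumes x: "x \<in> carrier_vec n"
  shows "x \<bullet> (partial_sum k *\<^sub>v x) = (\<Sum>l<k. x \<bullet> ((P * Z) ^\<^sub>m l * P *\<^sub>v x))"
proof (induction k)
  case 0
  have "0\<^sub>m n n *\<^sub>v x = 0\<^sub>v n" using x by (intro eq_vecI) auto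
  then show ?case using x by (simp add: mat_sum_0)
next
  case (Suc k)
  then show ?case
    unfolding partial_sum_Suc using quad_add[OF mat_sum_carrier term_carrier x] by simp
qed

text \<open>Two terms at a time: the partial sum with \<open>k + 2\<close> terms is \<open>P + P Z P\<close> plus a congruence of
  the one with \<open>k\<close> terms.\<close>

lemma partial_sum_pos_def:
  assumes "pos_def P" and pd: "pos_def (P + P * Z * P)" and "1 \<le> k"
  shows "pos_def (partial_sum k)"
proof (rule pos_defI[OF mat_sum_carrier partial_sum_sym])
  define q where "q x l = x \<bullet> ((P * Z) ^\<^sub>m l * P *\<^sub>v x)" for x l
  have q0: "q x 0 = x \<bullet> (P *\<^sub>v x)" for x using P Z by (simp add: q_def)
  have "P * Z * P = (P * Z) ^\<^sub>m Suc 0 * P" using P Z by simp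
  then have q01: "q x 0 + q x 1 = x \<bullet> ((P + P * Z * P) *\<^sub>v x)" if "x \<in> carrier_vec n" for x
    using quad_add[OF P mult_carrier_mat[OF PZ_carrier(1) P] that] by (simp add: q0) (simp add: q_def)
  \<comment> \<open>The induction goes down by two and evaluates the shorter sum at
    \<open>Z * P *\<^sub>v x\<close>, which may be zero, and possibly with no terms. Hence
    \<open>x\<close> stays arbitrary and nonnegativity is carried along with strict
    positivity.\<close>
  have nonneg: "0 \<le> (\<Sum>l<k. q x l) \<and> (1 \<le> k \<longrightarrow> x \<noteq> 0\<^sub>v n \<longrightarrow> 0 < (\<Sum>l<k. q x l))"
    if "x \<in> carrier_vec n" for x k
    using that
  proof (induction k arbitrary: x rule: induct_nat_012)
    case 1
    then show ?case using pos_def_quad_pos[OF assms(1) P] pos_def_quad_nonneg[OF assms(1) P] by (simp add: q0)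
  next
    case (ge2 k)
    let ?y = "Z * P *\<^sub>v x"
    have y: "?y \<in> carrier_vec n" using PZ_carrier(2) ge2(3) by (rule mult_mat_vec_carrier)
    have "(\<Sum>l<Suc (Suc k). q x l) = q x 0 + q x 1 + (\<Sum>l<k. q x (Suc (Suc l)))"
      by (simp only: sum.lessThan_Suc_shift) (simp add: add.assoc)
    also have "\<dots> = x \<bullet> ((P + P * Z * P) *\<^sub>v x) + (\<Sum>l<k. q ?y l)"
      using quad_term_add_2[OF ge2(3)] q01[OF ge2(3)] by (simp add: q_def)
    finally show ?case
      using ge2(1)[OF y] pos_def_quad_pos[OF pd _ ge2(3)] pos_def_quad_nonneg[OF pd _ ge2(3)]
        P Z by force
  qed simp
  show "0 < v \<bullet> (partial_sum k *\<^sub>v v)" if "v \<in> carrier_vec n" "v \<noteq> 0\<^sub>v n" for v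
    using nonneg[OF that(1), of k] that \<open>1 \<le> k\<close> quad_partial_sum[OF that(1)] by (simp add: q_def)
qed

text \<open>As \<open>P * M\<close> is the identity, the term with index \<open>k\<close> times
  \<open>M - Z\<close> is (P Z)^k - (P Z)^(k+1). In the application \<open>M\<close> is \<Phi> and
  \<open>M - Z\<close> is \<Psi>.\<close>

lemma partial_sum_telescope:
  assumes M: "M \<in> carrier_mat n n" and PM: "P * M = 1\<^sub>m n"
  shows "partial_sum k * (M - Z) = 1\<^sub>m n - (P * Z) ^\<^sub>m k"
proof (induction k)
  case 0
  show ?case
    using minus_carrier_mat[OF Z, of M] P Z by (intro eq_matI) (auto simp: mat_sum_0)
next
  case (Suc k)
  let ?W = "(P * Z) ^\<^sub>m k"
  have MZ: "M - Z \<in> carrier_mat n n" using Z by (rule minus_carrier_mat)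
  have "?W * P * (M - Z) = ?W * (1\<^sub>m n - P * Z)"
    using assoc_mult_mat[OF PZ_pow_carrier(1) P MZ] mult_minus_distrib_mat[OF P M Z] PM by simp
  also have "\<dots> = ?W - ?W * (P * Z)"
    unfolding mult_minus_distrib_mat[OF PZ_pow_carrier(1) one_carrier_mat PZ_carrier(1)]
      right_mult_one_mat[OF PZ_pow_carrier(1)] ..
  finally have "partial_sum (Suc k) * (M - Z) = (1\<^sub>m n - ?W) + (?W - ?W * (P * Z))"
    unfolding partial_sum_Suc add_mult_distrib_mat[OF mat_sum_carrier term_carrier MZ] Suc by simp
  also have "\<dots> = 1\<^sub>m n - ?W * (P * Z)"
    using PZ_pow_carrier(1)[of k] P Z by (intro eq_matI) auto
  finally show ?case by simp
qed

text \<open>Iterates \<open>partial_sum_comm\<close>: each factor \<open>P * Z\<close> passes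
  through the sum and comes out as \<open>Z * P\<close>.\<close>

lemma pow_partial_sum: "(P * Z) ^\<^sub>m h * partial_sum k = partial_sum k * (Z * P) ^\<^sub>m h"
proof (induction h)
  case 0
  then show ?case using P Z right_mult_one_mat[OF mat_sum_carrier] left_mult_one_mat[OF mat_sum_carrier] by simp
next
  case (Suc h)
  have "(P * Z) ^\<^sub>m Suc h * partial_sum k = (P * Z) ^\<^sub>m h * (partial_sum k * (Z * P))"
    using assoc_mult_mat[OF PZ_pow_carrier(1) PZ_carrier(1) mat_sum_carrier] partial_sum_comm by simp
  also have "\<dots> = partial_sum k * (Z * P) ^\<^sub>m h * (Z * P)"
    using assoc_mult_mat[OF PZ_pow_carrier(1) mat_sum_carrier PZ_carrier(2)] Suc by metis
  also have "\<dots> = partial_sum k * (Z * P) ^\<^sub>m Suc h"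
    using assoc_mult_mat[OF mat_sum_carrier PZ_pow_carrier(2) PZ_carrier(2)] by simp
  finally show ?case .
qed

text \<open>With \<open>U = partial_sum (h + h)\<close>, the defect \<open>U - U (M - Z) U\<close> equals \<open>(P Z)^h U (Z P)^h\<close>.\<close>

lemma partial_sum_defect_nonneg:
  assumes M: "M \<in> carrier_mat n n" and PM: "P * M = 1\<^sub>m n"
    and pd: "pos_def (partial_sum (h + h))" and x: "x \<in> carrier_vec n"
  defines "U \<equiv> partial_sum (h + h)"
  shows "0 \<le> x \<bullet> ((U - U * (M - Z) * U) *\<^sub>v x)"
proof -
  let ?W = "(P * Z) ^\<^sub>m h"
  have U: "U \<in> carrier_mat n n" by (simp add: U_def)
  have WW: "(P * Z) ^\<^sub>m (h + h) = ?W * ?W"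
    using pow_mat_add[OF PZ_carrier(1)] .
  have "U - U * (M - Z) * U = U - (1\<^sub>m n - ?W * ?W) * U"
    using partial_sum_telescope[OF M PM, of "h + h"] WW by (simp add: U_def)
  also have "(1\<^sub>m n - ?W * ?W) * U = U - ?W * ?W * U"
    using minus_mult_distrib_mat[OF one_carrier_mat _ U, of "?W * ?W"]
      PZ_pow_carrier(1)[of h] left_mult_one_mat[OF U] by simp
  also have "U - (U - ?W * ?W * U) = ?W * ?W * U"
    using U PZ_pow_carrier(1)[of h] by (intro eq_matI) auto
  \<comment> \<open>An even number of terms splits the remainder into two equal factors. One of them
    moves through \<open>U\<close> and comes out transposed, which turns the product into a
    congruence of \<open>U\<close>.\<close>
  also have "\<dots> = ?W * (U * (Z * P) ^\<^sub>m h)"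
    using assoc_mult_mat[OF PZ_pow_carrier(1) PZ_pow_carrier(1) U] pow_partial_sum by (simp add: U_def)
  also have "\<dots> = ?W * U * transpose_mat ?W"
    using assoc_mult_mat[OF PZ_pow_carrier(1) U PZ_pow_carrier(2)]
    by (simp add: transpose_pow[OF PZ_carrier(1)] transpose_PZ)
  finally show ?thesis
    using quad_congruence[OF PZ_pow_carrier(1) U x]
      pos_def_quad_nonneg[OF pd[folded U_def] U] x PZ_pow_carrier(1)[of h] by simp
qed

end

section \<open>Congruences and the nesting of two series\<close>

text \<open>The symmetric \<open>X\<close> will be the inverse of \<Phi>, the inner sum
  \<open>U\<close>, and the diagonal sign matrix.\<close>

lemma pos_def_congruence:
  assumes M: "M \<in> carrier_mat n n" "pos_def M"
    and X: "X \<in> carrier_mat n n" "transpose_mat X = X"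
    and ker: "\<And>v. v \<in> carrier_vec n \<Longrightarrow> X *\<^sub>v v = 0\<^sub>v n \<Longrightarrow> v = 0\<^sub>v n"
  shows "pos_def (X * M * X)"
proof (rule pos_defI)
  show "X * M * X \<in> carrier_mat n n" using M X by simp
  show "transpose_mat (X * M * X) = X * M * X"
    using transpose_congruence[OF X(1) M(1) pos_def_sym[OF M(2)]] X(2) by simp
  fix v :: "real vec" assume v: "v \<in> carrier_vec n" "v \<noteq> 0\<^sub>v n"
  then have "X *\<^sub>v v \<noteq> 0\<^sub>v n" using ker by blast
  then show "0 < v \<bullet> ((X * M * X) *\<^sub>v v)"
    using quad_congruence[OF X(1) M(1) v(1)] X(2) pos_def_quad_pos[OF M(2,1)] X(1) v(1) by simp
qed

lemma pos_def_ker: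
  assumes "pos_def A" "A \<in> carrier_mat n n" "v \<in> carrier_vec n" "A *\<^sub>v v = 0\<^sub>v n"
  shows "v = 0\<^sub>v n"
proof (rule pos_def_quad_eq_0[OF assms(1-3)])
  show "v \<bullet> (A *\<^sub>v v) \<le> 0" unfolding assms(4) using assms(3) by simp
qed

text \<open>The matrix-theoretic core, free of any block structure. Here \<Phi> - \<Omega> stands
  for \<Psi>, so the third positivity hypothesis is about \<Psi> + \<Xi>.\<close>

lemma nested_partial_sum_pos_def:
  fixes \<Phi> \<Omega> \<Xi> :: "real mat"
  assumes \<Phi>: "\<Phi> \<in> carrier_mat n n" "pos_def \<Phi>"
    and \<Omega>: "\<Omega> \<in> carrier_mat n n" "transpose_mat \<Omega> = \<Omega>" "pos_def (\<Phi> + \<Omega>)"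
    and \<Xi>: "\<Xi> \<in> carrier_mat n n" "transpose_mat \<Xi> = \<Xi>" "pos_def (\<Phi> - \<Omega> + \<Xi>)"
    and L: "even L" "1 \<le> L" and S: "1 \<le> S"
  defines "U \<equiv> mat_sum n (\<lambda>l. (minv \<Phi> * \<Omega>) ^\<^sub>m l * minv \<Phi>) L"
  shows "pos_def U" "pos_def (mat_sum n (\<lambda>s. (U * \<Xi>) ^\<^sub>m s * U) S)"
proof -
  let ?P = "minv \<Phi>"
  note P = minv_carrier[OF \<Phi>(2,1)] minv_right[OF \<Phi>(2,1)] minv_left[OF \<Phi>(2,1)]
    pos_def_minv_pos_def[OF \<Phi>(2,1)]
  note symP = pos_def_sym[OF P(4)]
  \<comment> \<open>Congruence by the inverse of \<Phi> turns \<Phi> + \<Omega> into the matrix P +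
    P Z P of the inner series.\<close>
  have "?P * (\<Phi> + \<Omega>) * ?P = (1\<^sub>m n + ?P * \<Omega>) * ?P"
    using mult_add_distrib_mat[OF P(1) \<Phi>(1) \<Omega>(1)] P(3) by simp
  also have "\<dots> = ?P + ?P * \<Omega> * ?P"
    using add_mult_distrib_mat[OF one_carrier_mat mult_carrier_mat[OF P(1) \<Omega>(1)] P(1)]
      left_mult_one_mat[OF P(1)] by simp
  finally have eq: "?P * (\<Phi> + \<Omega>) * ?P = ?P + ?P * \<Omega> * ?P" .
  have "pos_def (?P * (\<Phi> + \<Omega>) * ?P)"
  proof (rule pos_def_congruence[OF _ \<Omega>(3) P(1) symP])
    show "\<Phi> + \<Omega> \<in> carrier_mat n n" using \<Omega>(1) by (rule add_carrier_mat)
  qed (rule pos_def_ker[OF P(4,1)])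
  then have "pos_def (?P + ?P * \<Omega> * ?P)" unfolding eq .
  from partial_sum_pos_def[OF P(1) \<Omega>(1) symP \<Omega>(2) P(4) this L(2)]
  show pdU: "pos_def U" by (simp add: U_def)
  have U: "U \<in> carrier_mat n n" by (simp add: U_def)
  from L obtain h where h: "L = h + h" by (metis evenE mult_2)
  \<comment> \<open>\<open>D\<close> is the defect left by the inner series and is shown only to be
    nonnegative; strict positivity of the sum \<open>D + G\<close> comes from
    \<open>G\<close>.\<close>
  define D where "D = U - U * (\<Phi> - \<Omega>) * U"
  define G where "G = U * (\<Phi> - \<Omega> + \<Xi>) * U"
  have D: "D \<in> carrier_mat n n" and G: "G \<in> carrier_mat n n"
    using U \<Phi> \<Omega> \<Xi> by (auto simp: D_def G_def)
  have UXU: "U * \<Xi> * U \<in> carrier_mat n n" using U \<Xi> by simp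
  have \<Psi>: "\<Phi> - \<Omega> \<in> carrier_mat n n" using \<Omega>(1) by (rule minus_carrier_mat)
  have "G = U * (\<Phi> - \<Omega>) * U + U * \<Xi> * U"
    unfolding G_def mult_add_distrib_mat[OF U \<Psi> \<Xi>(1)]
    by (rule add_mult_distrib_mat[of _ n n]) (use U \<Psi> \<Xi> in auto)
  then have split: "U + U * \<Xi> * U = D + G"
    using U \<Psi> UXU by (intro eq_matI) (auto simp: D_def)
  have pdG: "pos_def G"
    unfolding G_def
  proof (rule pos_def_congruence[OF _ \<Xi>(3) U pos_def_sym[OF pdU]])
    show "\<Phi> - \<Omega> + \<Xi> \<in> carrier_mat n n" using \<Xi>(1) by (rule add_carrier_mat)
  qed (rule pos_def_ker[OF pdU U])
  have "pos_def (U + U * \<Xi> * U)"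
  proof (rule pos_defI)
    show "U + U * \<Xi> * U \<in> carrier_mat n n" using U UXU by simp
    show "transpose_mat (U + U * \<Xi> * U) = U + U * \<Xi> * U"
      using transpose_add[OF U UXU] transpose_congruence[OF U \<Xi>(1,2)] pos_def_sym[OF pdU] by simp
    fix v :: "real vec" assume v: "v \<in> carrier_vec n" "v \<noteq> 0\<^sub>v n"
    have "0 \<le> v \<bullet> (D *\<^sub>v v)"
      using partial_sum_defect_nonneg[OF P(1) \<Omega>(1) symP \<Omega>(2) \<Phi>(1) P(3) _ v(1), of h] pdU
      by (simp add: D_def U_def h)
    then show "0 < v \<bullet> ((U + U * \<Xi> * U) *\<^sub>v v)"
      unfolding split using quad_add[OF D G v(1)] pos_def_quad_pos[OF pdG G v] by simp
  qed
  from partial_sum_pos_def[OF U \<Xi>(1) pos_def_sym[OF pdU] \<Xi>(2) pdU this S]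
  show "pos_def (mat_sum n (\<lambda>s. (U * \<Xi>) ^\<^sub>m s * U) S)" .
qed

section \<open>Block matrices\<close>

lemma offset_0 [simp]: "offset w 0 = 0"
  by (simp add: offset_def)

lemma offset_Suc [simp]: "offset w (Suc a) = offset w a + w a"
  by (simp add: offset_def)

lemma offset_mono: "a \<le> b \<Longrightarrow> offset w a \<le> offset w b"
  unfolding offset_def by (rule sum_mono2) auto

lemma offset_const: "offset (\<lambda>_. n) a = n * a"
  by (simp add: offset_def)

text \<open>Offsets are monotone, so any smaller block ends at or before \<open>offset w a\<close>.
  Empty blocks are allowed, as no \<open>p\<close> satisfies both bounds for them.\<close>

lemma block_index_eqI:
  assumes "offset w a \<le> p" "p < offset w (Suc a)"
  shows "block_index w p = a"
  unfolding block_index_def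
proof (rule Least_equality)
  show "p < offset w (Suc a)" by (rule assms(2))
  fix b assume "p < offset w (Suc b)"
  then show "a \<le> b" using offset_mono[of "Suc b" a w] assms(1) by (meson leD not_less_eq_eq order_trans)
qed

lemma block_index_bounds:
  assumes "p < offset w k"
  shows "block_index w p < k" "offset w (block_index w p) \<le> p" "p < offset w (Suc (block_index w p))"
proof -
  from assms obtain k' where k: "k = Suc k'" by (cases k) auto
  have le: "block_index w p \<le> k'"
    unfolding block_index_def using assms k by (intro Least_le) simp
  then show "block_index w p < k" using k by simp
  show "p < offset w (Suc (block_index w p))"
    unfolding block_index_def by (rule LeastI[of _ k']) (use assms k in simp)
  show "offset w (block_index w p) \<le> p"
  proof (cases "block_index w p")
    case (Suc b)
    then have "\<not> p < offset w (Suc b)"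
      unfolding block_index_def by (intro not_less_Least) simp
    then show ?thesis using Suc by simp
  qed simp
qed

lemma block_tridiag_carrier: "block_tridiag k w Lo D Up \<in> carrier_mat (offset w k) (offset w k)"
  by (simp add: block_tridiag_def block_mat_def)

lemma blkdiag_0: "blkdiag 0 D = 0\<^sub>m 0 0"
  by (simp add: blkdiag_def)

lemma blkdiag_Suc:
  "blkdiag (Suc k) D = four_block_mat (blkdiag k D)
     (0\<^sub>m (dim_row (blkdiag k D)) (dim_col (D k))) (0\<^sub>m (dim_row (D k)) (dim_col (blkdiag k D))) (D k)"
  by (simp add: blkdiag_def diag_block_mat_last Let_def)

lemma blkdiag_carrier:
  assumes "\<And>a. a < k \<Longrightarrow> D a \<in> carrier_mat (w a) (u a)"
  shows "blkdiag k D \<in> carrier_mat (offset w k) (offset u k)"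
  using assms
proof (induction k)
  case (Suc k)
  then have "blkdiag k D \<in> carrier_mat (offset w k) (offset u k)" "D k \<in> carrier_mat (w k) (u k)"
    by auto
  then show ?case by (auto simp: blkdiag_Suc)
qed (simp add: blkdiag_0)

text \<open>Replaces the list recursion behind \<open>blkdiag\<close> by a formula for the entries.
  Rows and columns have their own partitions \<open>w\<close> and \<open>u\<close> because the
  blocks of \<open>B_hat\<close> need not be square.\<close>

lemma blkdiag_index:
  assumes "\<And>a. a < k \<Longrightarrow> D a \<in> carrier_mat (w a) (u a)" "p < offset w k" "q < offset u k"
  shows "blkdiag k D $$ (p, q) = (if block_index w p = block_index u q
    then D (block_index w p) $$ (p - offset w (block_index w p), q - offset u (block_index u q)) else 0)"
  using assms
proof (induction k)
  case (Suc k)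
  have D: "blkdiag k D \<in> carrier_mat (offset w k) (offset u k)"
    by (rule blkdiag_carrier) (use Suc.prems in auto)
  have Dk: "D k \<in> carrier_mat (w k) (u k)" using Suc.prems by simp
  have p: "block_index w p = k" if "\<not> p < offset w k"
    by (rule block_index_eqI) (use that Suc.prems in auto)
  have q: "block_index u q = k" if "\<not> q < offset u k"
    by (rule block_index_eqI) (use that Suc.prems in auto)
  have IH: "p < offset w k \<Longrightarrow> q < offset u k \<Longrightarrow> blkdiag k D $$ (p, q) = (if block_index w p = block_index u q
    then D (block_index w p) $$ (p - offset w (block_index w p), q - offset u (block_index u q)) else 0)"
    using Suc.prems by (intro Suc.IH) auto
  note dims = carrier_matD[OF D] carrier_matD[OF Dk]
  consider "p < offset w k" "q < offset u k" | "p < offset w k" "\<not> q < offset u k"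
    | "\<not> p < offset w k" "q < offset u k" | "\<not> p < offset w k" "\<not> q < offset u k" by blast
  then show ?case
  proof cases
    case 1
    then show ?thesis using IH Suc.prems(2,3) by (simp add: blkdiag_Suc dims)
  next
    case 2
    then have "blkdiag (Suc k) D $$ (p, q) = 0"
      using Suc.prems(3) by (simp add: blkdiag_Suc dims)
    then show ?thesis using q[OF 2(2)] block_index_bounds(1)[OF 2(1)] by auto
  next
    case 3
    then have "blkdiag (Suc k) D $$ (p, q) = 0"
      using Suc.prems(2) by (simp add: blkdiag_Suc dims)
    then show ?thesis using p[OF 3(1)] block_index_bounds(1)[OF 3(2)] by auto
  next
    case 4
    then show ?thesis using p q Suc.prems(2,3) by (simp add: blkdiag_Suc dims)
  qed
qed simp

lemma pos_def_four_block:
  assumes A: "A \<in> carrier_mat n n" "pos_def A" and B: "B \<in> carrier_mat m m" "pos_def B"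
  shows "pos_def (four_block_mat A (0\<^sub>m n m) (0\<^sub>m m n) B)"
proof (rule pos_defI)
  show "four_block_mat A (0\<^sub>m n m) (0\<^sub>m m n) B \<in> carrier_mat (n + m) (n + m)"
    using A B by simp
  show "transpose_mat (four_block_mat A (0\<^sub>m n m) (0\<^sub>m m n) B) = four_block_mat A (0\<^sub>m n m) (0\<^sub>m m n) B"
    using transpose_four_block_mat[OF A(1) _ _ B(1), of "0\<^sub>m n m" "0\<^sub>m m n"]
      pos_def_sym[OF A(2)] pos_def_sym[OF B(2)] by simp
  fix v :: "real vec" assume v: "v \<in> carrier_vec (n + m)" "v \<noteq> 0\<^sub>v (n + m)"
  define x y where "x = vec_first v n" and "y = vec_last v m"
  have xy: "x \<in> carrier_vec n" "y \<in> carrier_vec m" "v = x @\<^sub>v y"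
    using v by (auto simp: x_def y_def)
  have "v \<bullet> (four_block_mat A (0\<^sub>m n m) (0\<^sub>m m n) B *\<^sub>v v) = x \<bullet> (A *\<^sub>v x) + y \<bullet> (B *\<^sub>v y)"
    unfolding xy(3) mult_mat_vec_split[OF A(1) B(1) xy(1,2)]
    using A B xy by (intro scalar_prod_append) auto
  moreover have "x \<noteq> 0\<^sub>v n \<or> y \<noteq> 0\<^sub>v m"
    using v(2) xy(3) by auto
  ultimately show "0 < v \<bullet> (four_block_mat A (0\<^sub>m n m) (0\<^sub>m m n) B *\<^sub>v v)"
    using pos_def_quad_pos[OF A(2,1) xy(1)] pos_def_quad_pos[OF B(2,1) xy(2)]
      pos_def_quad_nonneg[OF A(2,1) xy(1)] pos_def_quad_nonneg[OF B(2,1) xy(2)] by force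
qed

lemma pos_def_blkdiag:
  assumes "\<And>a. a < k \<Longrightarrow> D a \<in> carrier_mat (w a) (w a)" "\<And>a. a < k \<Longrightarrow> pos_def (D a)"
  shows "pos_def (blkdiag k D)"
  using assms
proof (induction k)
  case 0
  show ?case by (rule pos_defI[of _ 0]) (auto simp: blkdiag_0)
next
  case (Suc k)
  have D: "blkdiag k D \<in> carrier_mat (offset w k) (offset w k)"
    by (rule blkdiag_carrier) (use Suc.prems in auto)
  have Dk: "D k \<in> carrier_mat (w k) (w k)" using Suc.prems by simp
  show ?case
    using pos_def_four_block[OF D _ Dk] Suc D carrier_matD[OF Dk] by (simp add: blkdiag_Suc)
qed

section \<open>Block bandwidth of products and inverses\<close>

text \<open>\<open>f\<close> and \<open>g\<close> number the blocks of rows and columns; two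
  numberings are kept so that \<open>B_hat\<close>, with state rows and input columns, fits in.
  Integers avoid truncated subtraction.\<close>

definition bandwidth :: "(nat \<Rightarrow> nat) \<Rightarrow> (nat \<Rightarrow> nat) \<Rightarrow> int \<Rightarrow> real mat \<Rightarrow> bool" where
  "bandwidth f g b M \<longleftrightarrow> (\<forall>p < dim_row M. \<forall>q < dim_col M.
     M $$ (p, q) \<noteq> 0 \<longrightarrow> \<bar>int (f p) - int (g q)\<bar> \<le> b)"

lemma bandwidth_mono: "bandwidth f g b M \<Longrightarrow> b \<le> c \<Longrightarrow> bandwidth f g c M"
  unfolding bandwidth_def by (meson order_trans)

lemma bandwidth_transpose: "bandwidth f g b M \<Longrightarrow> bandwidth g f b (transpose_mat M)"
  unfolding bandwidth_def by (auto simp: abs_minus_commute)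

lemma bandwidth_add:
  assumes "A \<in> carrier_mat n m" "B \<in> carrier_mat n m" "bandwidth f g b A" "bandwidth f g b B"
  shows "bandwidth f g b (A + B)"
  using assms unfolding bandwidth_def by (metis add_0 carrier_matD index_add_mat)

text \<open>A nonzero entry of the product has a nonzero summand, and the triangle inequality runs
  through the block of its middle index.\<close>

lemma bandwidth_mult:
  assumes A: "A \<in> carrier_mat n m" and B: "B \<in> carrier_mat m k"
    and bA: "bandwidth f g b A" and bB: "bandwidth g h c B"
  shows "bandwidth f h (b + c) (A * B)"
  unfolding bandwidth_def
proof (intro allI impI)
  fix p q assume pq: "p < dim_row (A * B)" "q < dim_col (A * B)" "(A * B) $$ (p, q) \<noteq> 0"
  then have "(\<Sum>i<m. A $$ (p, i) * B $$ (i, q)) \<noteq> 0"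
    using A B by (simp add: scalar_prod_def atLeast0LessThan)
  then obtain i where i: "i < m" "A $$ (p, i) * B $$ (i, q) \<noteq> 0"
    by (meson lessThan_iff sum.neutral)
  have "\<bar>int (f p) - int (g i)\<bar> \<le> b" "\<bar>int (g i) - int (h q)\<bar> \<le> c"
    using bA bB i pq A B unfolding bandwidth_def by auto
  then show "\<bar>int (f p) - int (h q)\<bar> \<le> b + c" by linarith
qed

text \<open>Bandwidth 0 means commuting with the diagonal matrix of \<open>f\<close>, a property inherited by the
  inverse.\<close>

lemma bandwidth_minv:
  assumes A: "A \<in> carrier_mat n n" "pos_def A" and b: "bandwidth f f 0 A"
  shows "bandwidth f f 0 (minv A)"
proof -
  let ?D = "mat_diag n (\<lambda>p. real (f p))"
  let ?B = "minv A"
  note B = minv_carrier[OF A(2,1)] minv_right[OF A(2,1)] minv_left[OF A(2,1)]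
  have D: "?D \<in> carrier_mat n n" by simp
  have comm: "?D * A = A * ?D"
    unfolding mat_diag_mult_left[OF A(1)] mat_diag_mult_right[OF A(1)]
    using A(1) b by (intro eq_matI) (auto simp: bandwidth_def)
  have "?D * ?B = ?B * A * (?D * ?B)"
    using B left_mult_one_mat[OF mult_carrier_mat[OF D B(1)]] by simp
  also have "\<dots> = ?B * (A * ?D * ?B)"
    using assoc_mult_mat[OF B(1) A(1) mult_carrier_mat[OF D B(1)]] assoc_mult_mat[OF A(1) D B(1)] by simp
  also have "\<dots> = ?B * (?D * (A * ?B))"
    unfolding comm[symmetric] using assoc_mult_mat[OF D A(1) B(1)] by simp
  also have "\<dots> = ?B * ?D"
    using B D right_mult_one_mat[OF D] by simp
  finally have "?D * ?B = ?B * ?D" .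
  then have eq: "mat n n (\<lambda>(i, j). real (f i) * ?B $$ (i, j)) = mat n n (\<lambda>(i, j). ?B $$ (i, j) * real (f j))"
    unfolding mat_diag_mult_left[OF B(1)] mat_diag_mult_right[OF B(1)] .
  \<comment> \<open>Entrywise, commuting says that \<open>f p - f q\<close> times the entry is 0, so
    a nonzero entry forces equal blocks.\<close>
  have "real (f p) * ?B $$ (p, q) = ?B $$ (p, q) * real (f q)" if "p < n" "q < n" for p q
    using arg_cong[OF eq, of "\<lambda>M. M $$ (p, q)"] that by simp
  then show ?thesis using B(1) unfolding bandwidth_def by force
qed

lemma bandwidth_blkdiag:
  assumes "\<And>a. a < k \<Longrightarrow> D a \<in> carrier_mat (w a) (u a)"
  shows "bandwidth (block_index w) (block_index u) 0 (blkdiag k D)"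
proof -
  have c: "blkdiag k D \<in> carrier_mat (offset w k) (offset u k)"
    by (rule blkdiag_carrier) (rule assms)
  show ?thesis
    unfolding bandwidth_def carrier_matD[OF c]
  proof (intro allI impI)
    fix p q assume pq: "p < offset w k" "q < offset u k" "blkdiag k D $$ (p, q) \<noteq> 0"
    then have "block_index w p = block_index u q"
      using blkdiag_index[of k D w u p q, OF assms] by (auto split: if_splits)
    then show "\<bar>int (block_index w p) - int (block_index u q)\<bar> \<le> 0" by simp
  qed
qed

lemma bandwidth_block_tridiag:
  "bandwidth (block_index w) (block_index w) 1 (block_tridiag k w Lo D Up)"
  unfolding bandwidth_def
proof (intro allI impI)
  let ?M = "block_tridiag k w Lo D Up"
  fix p q assume pq: "p < dim_row ?M" "q < dim_col ?M" "?M $$ (p, q) \<noteq> 0"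
  then have lt: "p < offset w k" "q < offset w k" by (auto simp: block_tridiag_def block_mat_def)
  note b = block_index_bounds[OF lt(1)] block_index_bounds[OF lt(2)]
  show "\<bar>int (block_index w p) - int (block_index w q)\<bar> \<le> 1"
    using pq(3) lt b by (auto simp: block_tridiag_def block_mat_def Let_def split: if_splits)
qed

section \<open>Quadratic forms and matrices split into blocks of equal size\<close>

text \<open>A new last row and column contribute only their common diagonal entry and its two
  neighbours.\<close>

lemma sum_tridiag:
  fixes g :: "nat \<Rightarrow> nat \<Rightarrow> real"
  assumes "\<And>a b. Suc a < b \<Longrightarrow> g a b = 0" "\<And>a b. Suc b < a \<Longrightarrow> g a b = 0"
  shows "(\<Sum>a<Suc k. \<Sum>b<Suc k. g a b) = (\<Sum>a<Suc k. g a a) + (\<Sum>a<k. g a (Suc a) + g (Suc a) a)"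
proof (induction k)
  case (Suc k)
  have "(\<Sum>a<Suc k. g a (Suc k)) = g k (Suc k)" "(\<Sum>b<Suc k. g (Suc k) b) = g (Suc k) k"
    using assms by simp_all
  then have "(\<Sum>a<Suc (Suc k). \<Sum>b<Suc (Suc k). g a b)
    = (\<Sum>a<Suc k. \<Sum>b<Suc k. g a b) + g k (Suc k) + g (Suc k) k + g (Suc k) (Suc k)"
    by (simp add: sum.distrib)
  then show ?case using Suc by simp
qed simp

lemma sum_blocks:
  fixes f :: "nat \<Rightarrow> real"
  shows "(\<Sum>p<n * k. f p) = (\<Sum>a<k. \<Sum>i<n. f (a * n + i))"
proof (induction k)
  case (Suc k)
  have "(\<Sum>p<n * Suc k. f p) = (\<Sum>p<n * k. f p) + (\<Sum>i<n. f (n * k + i))"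
    using sum.nat_group[of f n k] sum.atLeastLessThan_concat[of 0 "n * k" "n * k + n" f]
      sum.shift_bounds_nat_ivl[of f 0 "n * k" n]
    by (simp add: atLeast0LessThan add.commute)
  then show ?case using Suc by (simp add: mult.commute)
qed simp

lemma block_pos_less:
  assumes "a < k" "i < n"
  shows "a * n + i < n * (k :: nat)"
proof -
  have "a * n + i < Suc a * n" using assms by simp
  also have "\<dots> \<le> n * k" using assms by (metis Suc_leI mult.commute mult_le_mono2)
  finally show ?thesis .
qed

text \<open>All time blocks have the same width, so positions are written directly as
  \<open>a * n + i\<close>, without \<open>offset\<close> and \<open>block_index\<close>.\<close>

definition sub_vec :: "nat \<Rightarrow> real vec \<Rightarrow> nat \<Rightarrow> real vec" where
  "sub_vec n v a = vec n (\<lambda>i. v $ (a * n + i))"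

definition sub_mat :: "nat \<Rightarrow> real mat \<Rightarrow> nat \<Rightarrow> nat \<Rightarrow> real mat" where
  "sub_mat n M a b = mat n n (\<lambda>(i, j). M $$ (a * n + i, b * n + j))"

lemma quad_blocks:
  assumes M: "M \<in> carrier_mat (n * k) (n * k)" and v: "v \<in> carrier_vec (n * k)"
  shows "v \<bullet> (M *\<^sub>v v) = (\<Sum>a<k. \<Sum>b<k. sub_vec n v a \<bullet> (sub_mat n M a b *\<^sub>v sub_vec n v b))"
proof -
  have "v \<bullet> (M *\<^sub>v v) = (\<Sum>p<n * k. v $ p * (\<Sum>q<n * k. M $$ (p, q) * v $ q))"
    using M v by (simp add: scalar_prod_def atLeast0LessThan)
  also have "\<dots> = (\<Sum>a<k. \<Sum>i<n. \<Sum>b<k. v $ (a * n + i) * (\<Sum>j<n. M $$ (a * n + i, b * n + j) * v $ (b * n + j)))"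
    unfolding sum_blocks sum_distrib_left ..
  also have "\<dots> = (\<Sum>a<k. \<Sum>b<k. \<Sum>i<n. v $ (a * n + i) * (\<Sum>j<n. M $$ (a * n + i, b * n + j) * v $ (b * n + j)))"
    by (intro sum.cong refl sum.swap)
  also have "\<dots> = (\<Sum>a<k. \<Sum>b<k. sub_vec n v a \<bullet> (sub_mat n M a b *\<^sub>v sub_vec n v b))"
    by (intro sum.cong refl) (simp add: scalar_prod_def sub_vec_def sub_mat_def atLeast0LessThan)
  finally show ?thesis .
qed

lemma sub_vec_eq_0:
  assumes "v \<in> carrier_vec (n * k)" "\<And>a. a < k \<Longrightarrow> sub_vec n v a = 0\<^sub>v n"
  shows "v = 0\<^sub>v (n * k)"
proof (rule eq_vecI)
  fix p assume "p < dim_vec (0\<^sub>v (n * k) :: real vec)"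
  then have p: "p < n * k" by simp
  then have n: "0 < n" by (cases n) auto
  have "p div n < k" using p by (simp add: less_mult_imp_div_less mult.commute)
  then have "sub_vec n v (p div n) $ (p mod n) = 0" using assms(2) n by simp
  then show "v $ p = 0\<^sub>v (n * k) $ p" using n p by (simp add: sub_vec_def)
qed (use assms in simp)

lemma sub_mat_carrier [simp]: "sub_mat n M a b \<in> carrier_mat n n"
  by (simp add: sub_mat_def)

lemma dim_sub_mat [simp]: "dim_row (sub_mat n M a b) = n" "dim_col (sub_mat n M a b) = n"
  by (simp_all add: sub_mat_def)

lemma sub_vec_carrier [simp]: "sub_vec n v a \<in> carrier_vec n"
  by (simp add: sub_vec_def)

lemma sub_mat_add:
  assumes "A \<in> carrier_mat (n * k) (n * k)" "B \<in> carrier_mat (n * k) (n * k)" "a < k" "b < k"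
  shows "sub_mat n (A + B) a b = sub_mat n A a b + sub_mat n B a b"
  using assms by (intro eq_matI) (auto simp: sub_mat_def block_pos_less)

lemma sub_mat_minus:
  assumes "A \<in> carrier_mat (n * k) (n * k)" "B \<in> carrier_mat (n * k) (n * k)" "a < k" "b < k"
  shows "sub_mat n (A - B) a b = sub_mat n A a b - sub_mat n B a b"
  using assms by (intro eq_matI) (auto simp: sub_mat_def block_pos_less)

lemma sub_mat_transpose:
  assumes "A \<in> carrier_mat (n * k) (n * k)" "a < k" "b < k"
  shows "sub_mat n (transpose_mat A) a b = transpose_mat (sub_mat n A b a)"
  using assms by (intro eq_matI) (auto simp: sub_mat_def block_pos_less)

lemma sub_mat_eqI:
  assumes A: "A \<in> carrier_mat (n * k) (n * k)" and B: "B \<in> carrier_mat (n * k) (n * k)"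
    and eq: "\<And>a b. a < k \<Longrightarrow> b < k \<Longrightarrow> sub_mat n A a b = sub_mat n B a b"
  shows "A = B"
proof (rule eq_matI)
  fix p q assume "p < dim_row B" "q < dim_col B"
  then have pq: "p < n * k" "q < n * k" using B by auto
  then have n: "0 < n" by (cases n) auto
  have "p div n < k" "q div n < k" using pq by (simp_all add: less_mult_imp_div_less mult.commute)
  then have "sub_mat n A (p div n) (q div n) $$ (p mod n, q mod n)
    = sub_mat n B (p div n) (q div n) $$ (p mod n, q mod n)" using eq by simp
  then show "A $$ (p, q) = B $$ (p, q)" using n by (simp add: sub_mat_def)
qed (use A B in auto)

lemma block_index_const_pos: "i < n \<Longrightarrow> block_index (\<lambda>_. n) (a * n + i) = a"
  by (rule block_index_eqI) (auto simp: offset_const mult.commute)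

lemma block_offset_diff: "a * n + i - n * a = (i :: nat)"
  by (simp add: mult.commute)

lemma sub_mat_blkdiag:
  assumes D: "\<And>a. a < k \<Longrightarrow> D a \<in> carrier_mat n n" and ab: "a < k" "b < k"
  shows "sub_mat n (blkdiag k D) a b = (if a = b then D a else 0\<^sub>m n n)"
proof (rule eq_matI)
  fix i j assume "i < dim_row (if a = b then D a else 0\<^sub>m n n)" "j < dim_col (if a = b then D a else 0\<^sub>m n n)"
  then have ij: "i < n" "j < n" using D[OF ab(1)] by (auto split: if_splits)
  have "blkdiag k D $$ (a * n + i, b * n + j) = (if a = b then D a $$ (i, j) else 0)"
    using blkdiag_index[of k D "\<lambda>_. n" "\<lambda>_. n" "a * n + i" "b * n + j", OF D] ab ij
    by (simp add: offset_const block_pos_less block_index_const_pos block_offset_diff)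
  then show "sub_mat n (blkdiag k D) a b $$ (i, j) = (if a = b then D a else 0\<^sub>m n n) $$ (i, j)"
    using ij by (simp add: sub_mat_def)
qed (use D[OF ab(1)] in auto)

lemma sub_mat_block_tridiag:
  assumes ab: "a < k" "b < k"
    and "D a \<in> carrier_mat n n" "b = Suc a \<Longrightarrow> Up a \<in> carrier_mat n n" "a = Suc b \<Longrightarrow> Lo a \<in> carrier_mat n n"
  shows "sub_mat n (block_tridiag k (\<lambda>_. n) Lo D Up) a b =
    (if b = a then D a else if b = Suc a then Up a else if a = Suc b then Lo a else 0\<^sub>m n n)"
    (is "_ = ?R")
proof (rule eq_matI)
  have R: "?R \<in> carrier_mat n n" using assms by auto
  fix i j assume "i < dim_row ?R" "j < dim_col ?R"
  then have ij: "i < n" "j < n" using R by auto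
  define p q where "p = a * n + i" and "q = b * n + j"
  have "p < n * k" "block_index (\<lambda>_. n) p = a" "p - n * a = i"
    "q < n * k" "block_index (\<lambda>_. n) q = b" "q - n * b = j"
    using ab ij by (simp_all add: p_def q_def block_pos_less block_index_const_pos block_offset_diff)
  then have "block_tridiag k (\<lambda>_. n) Lo D Up $$ (p, q) = ?R $$ (i, j)"
    using ij unfolding block_tridiag_def block_mat_def by (simp add: offset_const Let_def)
  then show "sub_mat n (block_tridiag k (\<lambda>_. n) Lo D Up) a b $$ (i, j) = ?R $$ (i, j)"
    using ij by (simp add: sub_mat_def p_def q_def)
qed (use assms in auto)

lemma quad_square:
  fixes Q :: "real mat"
  assumes Q: "Q \<in> carrier_mat n n" "transpose_mat Q = Q" and x: "x \<in> carrier_vec n" and y: "y \<in> carrier_vec n"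
  shows "(x + y) \<bullet> (Q *\<^sub>v (x + y)) = x \<bullet> (Q *\<^sub>v x) + 2 * (y \<bullet> (Q *\<^sub>v x)) + y \<bullet> (Q *\<^sub>v y)"
proof -
  have c: "Q *\<^sub>v x \<in> carrier_vec n" "Q *\<^sub>v y \<in> carrier_vec n" using Q x y by auto
  have "x \<bullet> (Q *\<^sub>v y) = y \<bullet> (Q *\<^sub>v x)"
    using scalar_prod_mult_mat_vec_left[OF Q(1) x y] Q(2) comm_scalar_prod[OF c(1) y] by simp
  then show ?thesis
    unfolding mult_add_distrib_mat_vec[OF Q(1) x y]
    by (simp add: scalar_prod_add_distrib[OF add_carrier_vec[OF x y] c]
      add_scalar_prod_distrib[OF x y c(1)] add_scalar_prod_distrib[OF x y c(2)])
qed

section \<open>The matrices of the control problem\<close>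

text \<open>The first \<open>v\<close> pairs make up the first \<open>2 * v\<close> columns. The
  minimum accounts for a final singleton when the number of columns is odd.\<close>

lemma offset_pair_dim: "offset (pair_dim d) v = offset (n_bar d) (min (2 * v) (gN d))"
proof (induction v)
  case (Suc v)
  have set: "{j. j < gN d \<and> j div 2 = v} = {min (2 * v) (gN d)..<min (2 * Suc v) (gN d)}"
    by (auto simp: min_def)
  have "offset (pair_dim d) (Suc v) = (\<Sum>j<min (2 * v) (gN d). n_bar d j) + pair_dim d v"
    using Suc by (simp add: offset_def)
  also have "\<dots> = offset (n_bar d) (min (2 * Suc v) (gN d))"
    unfolding pair_dim_def set offset_def lessThan_atLeast0 by (rule sum.atLeastLessThan_concat) auto
  finally show ?case .
qed simp

lemma n_hat_offset: "n_hat d = offset (n_bar d) (gN d)"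
  by (simp add: n_hat_def offset_def)

lemma offset_num_pairs: "offset (pair_dim d) (num_pairs d) = n_hat d"
proof -
  have "min (2 * num_pairs d) (gN d) = gN d" by (auto simp: num_pairs_def)
  then show ?thesis by (simp add: offset_pair_dim n_hat_offset)
qed

text \<open>Translates bandwidths: columns at distance at most 2 lie in equal or adjacent pairs, so
  penta-diagonal by columns is tri-diagonal by pairs.\<close>

lemma block_index_pair_dim:
  assumes "p < n_hat d"
  shows "block_index (pair_dim d) p = block_index (n_bar d) p div 2"
proof (rule block_index_eqI)
  let ?j = "block_index (n_bar d) p"
  note b = block_index_bounds[OF assms[unfolded n_hat_offset]]
  have "offset (n_bar d) (min (2 * (?j div 2)) (gN d)) \<le> offset (n_bar d) ?j"
    by (rule offset_mono) auto
  then show "offset (pair_dim d) (?j div 2) \<le> p"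
    unfolding offset_pair_dim using b(2) by linarith
  have "offset (n_bar d) (Suc ?j) \<le> offset (n_bar d) (min (2 * Suc (?j div 2)) (gN d))"
    using b(1) by (intro offset_mono) auto
  then show "p < offset (pair_dim d) (Suc (?j div 2))"
    unfolding offset_pair_dim using b(3) by linarith
qed

section \<open>Dimensions, positivity and bandwidth of the stacked matrices\<close>

context
  fixes d :: lq_data
  assumes lq: "lq_problem d"
begin

abbreviation "nh \<equiv> n_hat d"
abbreviation "mh \<equiv> offset (\<lambda>j. offset (\<lambda>i. udim d i j) (gK d)) (gN d)"
abbreviation "col_of \<equiv> block_index (n_bar d)"
abbreviation "pair_of \<equiv> block_index (pair_dim d)"

lemma n_bar_offset: "n_bar d j = offset (\<lambda>i. xdim d i j) (gK d)"
  by (simp add: n_bar_def offset_def)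

lemma Q_bar_props:
  assumes "j < gN d" "t \<le> gT d"
  shows "Q_bar d j t \<in> carrier_mat (n_bar d j) (n_bar d j)" "pos_def (Q_bar d j t)"
proof -
  have Q: "Qm d i j t \<in> carrier_mat (xdim d i j) (xdim d i j)" "pos_def (Qm d i j t)" if "i < gK d" for i
    using lq that assms by (auto simp: lq_problem_def)
  show "Q_bar d j t \<in> carrier_mat (n_bar d j) (n_bar d j)"
    unfolding Q_bar_def n_bar_offset by (rule blkdiag_carrier) (rule Q(1))
  show "pos_def (Q_bar d j t)"
    unfolding Q_bar_def by (rule pos_def_blkdiag) (rule Q; assumption)+
qed

lemma Q_hat_props:
  assumes "t \<le> gT d"
  shows "Q_hat d t \<in> carrier_mat nh nh" "pos_def (Q_hat d t)" "bandwidth col_of col_of 0 (Q_hat d t)"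
proof -
  show "Q_hat d t \<in> carrier_mat nh nh"
    unfolding Q_hat_def n_hat_offset by (rule blkdiag_carrier) (rule Q_bar_props(1)[OF _ assms])
  show "pos_def (Q_hat d t)"
    unfolding Q_hat_def by (rule pos_def_blkdiag) (rule Q_bar_props[OF _ assms]; assumption)+
  show "bandwidth col_of col_of 0 (Q_hat d t)"
    unfolding Q_hat_def by (rule bandwidth_blkdiag) (rule Q_bar_props(1)[OF _ assms])
qed

abbreviation "ucol_of \<equiv> block_index (\<lambda>j. offset (\<lambda>i. udim d i j) (gK d))"

lemma R_bar_props:
  assumes "j < gN d" "t < gT d"
  shows "R_bar d j t \<in> carrier_mat (offset (\<lambda>i. udim d i j) (gK d)) (offset (\<lambda>i. udim d i j) (gK d))"
    "pos_def (R_bar d j t)"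
proof -
  have R: "Rm d i j t \<in> carrier_mat (udim d i j) (udim d i j)" "pos_def (Rm d i j t)" if "i < gK d" for i
    using lq that assms by (auto simp: lq_problem_def)
  show "R_bar d j t \<in> carrier_mat (offset (\<lambda>i. udim d i j) (gK d)) (offset (\<lambda>i. udim d i j) (gK d))"
    unfolding R_bar_def by (rule blkdiag_carrier) (rule R(1))
  show "pos_def (R_bar d j t)"
    unfolding R_bar_def by (rule pos_def_blkdiag) (rule R; assumption)+
qed

lemma R_hat_props:
  assumes "t < gT d"
  shows "R_hat d t \<in> carrier_mat mh mh" "pos_def (R_hat d t)" "bandwidth ucol_of ucol_of 0 (R_hat d t)"
proof -
  show "R_hat d t \<in> carrier_mat mh mh"
    unfolding R_hat_def by (rule blkdiag_carrier) (rule R_bar_props(1)[OF _ assms])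
  show "pos_def (R_hat d t)"
    unfolding R_hat_def by (rule pos_def_blkdiag) (rule R_bar_props[OF _ assms]; assumption)+
  show "bandwidth ucol_of ucol_of 0 (R_hat d t)"
    unfolding R_hat_def by (rule bandwidth_blkdiag) (rule R_bar_props(1)[OF _ assms])
qed

lemma B_hat_props:
  assumes "t < gT d"
  shows "B_hat d t \<in> carrier_mat nh mh" "bandwidth col_of ucol_of 0 (B_hat d t)"
proof -
  have B: "B_bar d j t \<in> carrier_mat (n_bar d j) (offset (\<lambda>i. udim d i j) (gK d))" if "j < gN d" for j
    unfolding B_bar_def n_bar_offset
    by (rule blkdiag_carrier) (use lq that assms in \<open>auto simp: lq_problem_def\<close>)
  show "B_hat d t \<in> carrier_mat nh mh"
    unfolding B_hat_def n_hat_offset by (rule blkdiag_carrier) (rule B)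
  show "bandwidth col_of ucol_of 0 (B_hat d t)"
    unfolding B_hat_def by (rule bandwidth_blkdiag) (rule B)
qed

text \<open>Valid for every \<open>t\<close>, since \<open>block_tridiag\<close> itself fixes the
  dimensions and the zeros outside the band.\<close>

lemma A_hat_props: "A_hat d t \<in> carrier_mat nh nh" "bandwidth col_of col_of 1 (A_hat d t)"
  unfolding A_hat_def n_hat_offset by (rule block_tridiag_carrier, rule bandwidth_block_tridiag)

lemma Q_inv_props:
  assumes "t \<le> gT d"
  shows "minv (Q_hat d t) \<in> carrier_mat nh nh" "pos_def (minv (Q_hat d t))"
    "bandwidth col_of col_of 0 (minv (Q_hat d t))"
  using minv_carrier pos_def_minv_pos_def bandwidth_minv Q_hat_props[OF assms] by blast+

lemma R_inv_props:
  assumes "t < gT d"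
  shows "minv (R_hat d t) \<in> carrier_mat mh mh" "pos_def (minv (R_hat d t))"
    "bandwidth ucol_of ucol_of 0 (minv (R_hat d t))"
  using minv_carrier pos_def_minv_pos_def bandwidth_minv R_hat_props[OF assms] by blast+

text \<open>The three contributions stay separate so that the one from \<open>A_hat\<close> can
  later be combined with time \<open>t\<close>, and the one from \<open>Q_hat\<close> with time
  \<open>t + 1\<close>.\<close>

lemma quad_Psi_hat_Suc:
  assumes t: "t < gT d" and v: "v \<in> carrier_vec nh"
  shows "v \<bullet> (Psi_hat d (Suc t) *\<^sub>v v) = v \<bullet> (minv (Q_hat d (Suc t)) *\<^sub>v v)
    + (transpose_mat (A_hat d t) *\<^sub>v v) \<bullet> (minv (Q_hat d t) *\<^sub>v (transpose_mat (A_hat d t) *\<^sub>v v))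
    + (transpose_mat (B_hat d t) *\<^sub>v v) \<bullet> (minv (R_hat d t) *\<^sub>v (transpose_mat (B_hat d t) *\<^sub>v v))"
proof -
  note Q = Q_inv_props(1)[of t] Q_inv_props(1)[of "Suc t"] and A = A_hat_props(1)[of t]
    and B = B_hat_props(1)[OF t] and R = R_inv_props(1)[OF t]
  have c: "A_hat d t * minv (Q_hat d t) * transpose_mat (A_hat d t) \<in> carrier_mat nh nh"
    "B_hat d t * minv (R_hat d t) * transpose_mat (B_hat d t) \<in> carrier_mat nh nh"
    using Q A B R t by auto
  show ?thesis
    unfolding Psi_hat.simps
    using quad_add[OF add_carrier_mat[OF c(1)] c(2) v] quad_add[OF _ c(1) v] Q(2) t
      quad_congruence[OF A Q(1) v] quad_congruence[OF B R v] by simp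
qed

lemma Psi_hat_props:
  assumes t: "t \<le> gT d"
  shows "Psi_hat d t \<in> carrier_mat nh nh" "pos_def (Psi_hat d t)" "bandwidth col_of col_of 2 (Psi_hat d t)"
proof -
  have "Psi_hat d t \<in> carrier_mat nh nh \<and> pos_def (Psi_hat d t) \<and> bandwidth col_of col_of 2 (Psi_hat d t)"
  proof (cases t)
    case 0
    then show ?thesis using Q_inv_props[OF t] bandwidth_mono[of col_of col_of 0 _ 2] by auto
  next
    case (Suc s)
    then have s: "s < gT d" "s \<le> gT d" using t by auto
    note Q = Q_inv_props[OF s(2)] and Q' = Q_inv_props[OF t] and A = A_hat_props[of s]
      and B = B_hat_props[OF s(1)] and R = R_inv_props[OF s(1)]
    let ?X = "A_hat d s * minv (Q_hat d s) * transpose_mat (A_hat d s)"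
    let ?Y = "B_hat d s * minv (R_hat d s) * transpose_mat (B_hat d s)"
    have A': "transpose_mat (A_hat d s) \<in> carrier_mat nh nh" using A by simp
    have B': "transpose_mat (B_hat d s) \<in> carrier_mat mh nh" using B by simp
    have c: "?X \<in> carrier_mat nh nh" "?Y \<in> carrier_mat nh nh"
      using A(1) B(1) Q(1) R(1) by auto
    have P: "Psi_hat d t = minv (Q_hat d t) + ?X + ?Y" using Suc by simp
    have carr: "Psi_hat d t \<in> carrier_mat nh nh" unfolding P using c Q'(1) by simp
    have sym: "transpose_mat (Psi_hat d t) = Psi_hat d t"
      unfolding P transpose_add[OF add_carrier_mat[OF c(1)] c(2)] transpose_add[OF Q'(1) c(1)]
        transpose_congruence[OF A(1) Q(1) pos_def_sym[OF Q(2)]]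
        transpose_congruence[OF B(1) R(1) pos_def_sym[OF R(2)]]
        pos_def_sym[OF Q'(2)] ..
    have "pos_def (Psi_hat d t)"
    proof (rule pos_defI[OF carr sym])
      fix v :: "real vec" assume v: "v \<in> carrier_vec nh" "v \<noteq> 0\<^sub>v nh"
      have "transpose_mat (A_hat d s) *\<^sub>v v \<in> carrier_vec nh" "transpose_mat (B_hat d s) *\<^sub>v v \<in> carrier_vec mh"
        using A' B' v(1) by auto
      then show "0 < v \<bullet> (Psi_hat d t *\<^sub>v v)"
        using quad_Psi_hat_Suc[OF s(1) v(1)] pos_def_quad_pos[OF Q'(2,1) v]
          pos_def_quad_nonneg[OF Q(2,1)] pos_def_quad_nonneg[OF R(2,1)] unfolding Suc by fastforce
    qed
    \<comment> \<open>\<open>A_hat\<close> and its transpose each reach one column further and the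
      inverse of \<open>Q_hat\<close> none: this is the penta-diagonal pattern.\<close>
    moreover have "bandwidth col_of col_of (1 + 0 + 1) ?X"
      by (rule bandwidth_mult[OF mult_carrier_mat[OF A(1) Q(1)] A'
        bandwidth_mult[OF A(1) Q(1) A(2) Q(3)] bandwidth_transpose[OF A(2)]])
    moreover have "bandwidth col_of col_of (0 + 0 + 0) ?Y"
      by (rule bandwidth_mult[OF mult_carrier_mat[OF B(1) R(1)] B'
        bandwidth_mult[OF B(1) R(1) B(2) R(3)] bandwidth_transpose[OF B(2)]])
    moreover have "bandwidth col_of col_of 2 (minv (Q_hat d t))"
      by (rule bandwidth_mono[OF Q'(3)]) simp
    ultimately show ?thesis
      using carr bandwidth_mono[of col_of col_of 0 ?Y 2]
        bandwidth_add[OF Q'(1) c(1)] bandwidth_add[OF add_carrier_mat[OF c(1)] c(2)]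
      unfolding P by simp
  qed
  then show "Psi_hat d t \<in> carrier_mat nh nh" "pos_def (Psi_hat d t)"
    "bandwidth col_of col_of 2 (Psi_hat d t)" by auto
qed

section \<open>The inner splitting at one time step\<close>

lemma Phi_hat_carrier: "Phi_hat d t \<in> carrier_mat nh nh"
  unfolding Phi_hat_def offset_num_pairs[symmetric]
  by (rule blkdiag_carrier) (simp add: diag_block_def)

text \<open>Cutting out a diagonal block and putting it back shift positions by the same offset, so
  surviving entries stay in place.\<close>

lemma Phi_hat_index:
  assumes "p < nh" "q < nh"
  shows "Phi_hat d t $$ (p, q) = (if pair_of p = pair_of q then Psi_hat d t $$ (p, q) else 0)"
proof -
  have lt: "p < offset (pair_dim d) (num_pairs d)" "q < offset (pair_dim d) (num_pairs d)"
    using assms by (simp_all add: offset_num_pairs)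
  have "Phi_hat d t $$ (p, q) = (if pair_of p = pair_of q
    then diag_block (pair_dim d) (Psi_hat d t) (pair_of p)
      $$ (p - offset (pair_dim d) (pair_of p), q - offset (pair_dim d) (pair_of q)) else 0)"
    unfolding Phi_hat_def by (rule blkdiag_index[OF _ lt]) (simp add: diag_block_def)
  then show ?thesis
    using block_index_bounds[OF lt(1)] block_index_bounds[OF lt(2)] by (auto simp: diag_block_def)
qed

text \<open>Since \<open>Psi_hat\<close> is block tri-diagonal for the pairs of columns, flipping the signs of every
  other pair negates exactly its off-diagonal blocks.\<close>

lemma Phi_hat_reflection:
  assumes t: "t \<le> gT d"
  shows "Phi_hat d t + (Phi_hat d t - Psi_hat d t) =
    mat_diag nh (\<lambda>p. (-1) ^ pair_of p) * Psi_hat d t * mat_diag nh (\<lambda>p. (-1) ^ pair_of p)"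
    (is "_ = ?J * _ * ?J")
proof (rule eq_matI)
  note P = Psi_hat_props[OF t]
  have JP: "?J * Psi_hat d t \<in> carrier_mat nh nh" using P(1) by (intro mult_carrier_mat) auto
  have dims: "dim_row (?J * Psi_hat d t * ?J) = nh" "dim_col (?J * Psi_hat d t * ?J) = nh"
    by (auto simp: mat_diag_def)
  show "dim_row (Phi_hat d t + (Phi_hat d t - Psi_hat d t)) = dim_row (?J * Psi_hat d t * ?J)"
    "dim_col (Phi_hat d t + (Phi_hat d t - Psi_hat d t)) = dim_col (?J * Psi_hat d t * ?J)"
    unfolding dims using carrier_matD[OF P(1)] by simp_all
  fix p q assume "p < dim_row (?J * Psi_hat d t * ?J)" "q < dim_col (?J * Psi_hat d t * ?J)"
  then have pq: "p < nh" "q < nh" unfolding dims .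
  have r: "(?J * Psi_hat d t * ?J) $$ (p, q) = (-1) ^ pair_of p * Psi_hat d t $$ (p, q) * (-1) ^ pair_of q"
    unfolding mat_diag_mult_right[OF JP] using pq by (simp add: mat_diag_mult_left[OF P(1)])
  have l: "(Phi_hat d t + (Phi_hat d t - Psi_hat d t)) $$ (p, q) =
      2 * Phi_hat d t $$ (p, q) - Psi_hat d t $$ (p, q)"
    using pq carrier_matD[OF P(1)] carrier_matD[OF Phi_hat_carrier[of t]] by simp
  show "(Phi_hat d t + (Phi_hat d t - Psi_hat d t)) $$ (p, q) = (?J * Psi_hat d t * ?J) $$ (p, q)"
  proof (cases "Psi_hat d t $$ (p, q) = 0")
    case False
    have "\<bar>int (col_of p) - int (col_of q)\<bar> \<le> 2"
      using P(3) False pq carrier_matD[OF P(1)] unfolding bandwidth_def by simp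
    \<comment> \<open>In equal pairs the two signs cancel and \<open>Phi_hat\<close> agrees with
      \<open>Psi_hat\<close>; in adjacent pairs the signs multiply to -1 and \<open>Phi_hat\<close>
      vanishes.\<close>
    then have "pair_of p = pair_of q \<or> pair_of p = Suc (pair_of q) \<or> pair_of q = Suc (pair_of p)"
      unfolding block_index_pair_dim[OF pq(1)] block_index_pair_dim[OF pq(2)] by linarith
    moreover have "(-1) ^ k * x * (-1) ^ k = x" for k and x :: real
      by (simp add: mult.commute mult.left_commute flip: power_mult_distrib)
    ultimately show ?thesis
      unfolding l r Phi_hat_index[OF pq] by auto
  qed (simp add: l r Phi_hat_index[OF pq])
qed

lemma Phi_hat_reflection_pos_def:
  assumes t: "t \<le> gT d"
  shows "pos_def (Phi_hat d t + (Phi_hat d t - Psi_hat d t))"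
  unfolding Phi_hat_reflection[OF t]
proof (rule pos_def_congruence[OF Psi_hat_props(1,2)[OF t]])
  let ?J = "mat_diag nh (\<lambda>p. (-1 :: real) ^ pair_of p)"
  show J: "?J \<in> carrier_mat nh nh" by simp
  show "transpose_mat ?J = ?J" by (rule eq_matI) (auto simp: mat_diag_def)
  \<comment> \<open>Signs square to 1, so the sign matrix is its own inverse and has trivial
    kernel.\<close>
  have "mat_diag nh (\<lambda>p. (-1 :: real) ^ pair_of p * (-1) ^ pair_of p) = 1\<^sub>m nh"
    by (rule eq_matI) (auto simp: mat_diag_def simp flip: power_mult_distrib)
  then have JJ: "?J * ?J = 1\<^sub>m nh" by simp
  show "v = 0\<^sub>v nh" if "v \<in> carrier_vec nh" "?J *\<^sub>v v = 0\<^sub>v nh" for v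
  proof -
    have "v = ?J * ?J *\<^sub>v v" unfolding JJ using that(1) by simp
    also have "\<dots> = ?J *\<^sub>v 0\<^sub>v nh" unfolding assoc_mult_mat_vec[OF J J that(1)] that(2) ..
    also have "\<dots> = 0\<^sub>v nh" by (rule eq_vecI) (simp_all add: mat_diag_def)
    finally show ?thesis .
  qed
qed

text \<open>\<open>Phi_hat\<close> is half the sum of \<open>Psi_hat\<close> and its sign
  reflection, both positive definite.\<close>

lemma Phi_hat_pos_def:
  assumes t: "t \<le> gT d"
  shows "pos_def (Phi_hat d t)"
proof (rule pos_defI[OF Phi_hat_carrier])
  note P = Psi_hat_props[OF t] and F = Phi_hat_carrier[of t]
  have D: "Phi_hat d t - Psi_hat d t \<in> carrier_mat nh nh" using P(1) by (rule minus_carrier_mat)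
  have "Psi_hat d t $$ (q, p) = Psi_hat d t $$ (p, q)" if "p < nh" "q < nh" for p q
    using arg_cong[OF pos_def_sym[OF P(2)], of "\<lambda>M. M $$ (p, q)"] that P(1) by simp
  then show "transpose_mat (Phi_hat d t) = Phi_hat d t"
    using carrier_matD[OF F] by (intro eq_matI) (auto simp: Phi_hat_index)
  fix v :: "real vec" assume v: "v \<in> carrier_vec nh" "v \<noteq> 0\<^sub>v nh"
  have "0 < v \<bullet> ((Phi_hat d t + (Phi_hat d t - Psi_hat d t)) *\<^sub>v v)"
    by (rule pos_def_quad_pos[OF Phi_hat_reflection_pos_def[OF t] _ v]) (rule add_carrier_mat[OF D])
  then show "0 < v \<bullet> (Phi_hat d t *\<^sub>v v)"
    unfolding quad_add[OF F D v(1)] quad_minus[OF F P(1) v(1)]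
    using pos_def_quad_pos[OF P(2,1) v] by simp
qed

section \<open>The inner splitting over the whole horizon\<close>

lemma n_total_eq: "n_total d = nh * (gT d + 1)"
  by (simp add: n_total_def)

lemma Psi_props:
  "Psi d \<in> carrier_mat (n_total d) (n_total d)" "pos_def (Psi d)"
  unfolding Psi_def n_total_eq offset_const[symmetric]
proof -
  have P: "Psi_hat d t \<in> carrier_mat nh nh" "pos_def (Psi_hat d t)" if "t < gT d + 1" for t
    using Psi_hat_props that by simp_all
  show "blkdiag (gT d + 1) (Psi_hat d) \<in> carrier_mat (offset (\<lambda>_. nh) (gT d + 1)) (offset (\<lambda>_. nh) (gT d + 1))"
    by (rule blkdiag_carrier) (rule P(1))
  show "pos_def (blkdiag (gT d + 1) (Psi_hat d))"
    by (rule pos_def_blkdiag) (rule P; assumption)+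
qed

lemma Phi_props:
  "Phi d \<in> carrier_mat (n_total d) (n_total d)" "pos_def (Phi d)"
  unfolding Phi_def n_total_eq offset_const[symmetric]
proof -
  show "blkdiag (gT d + 1) (Phi_hat d) \<in> carrier_mat (offset (\<lambda>_. nh) (gT d + 1)) (offset (\<lambda>_. nh) (gT d + 1))"
    by (rule blkdiag_carrier) (rule Phi_hat_carrier)
  show "pos_def (blkdiag (gT d + 1) (Phi_hat d))"
    by (rule pos_def_blkdiag[OF Phi_hat_carrier]) (simp add: Phi_hat_pos_def)
qed

lemma Omega_carrier: "Omega d \<in> carrier_mat (n_total d) (n_total d)"
  unfolding Omega_def using Psi_props(1) by (rule minus_carrier_mat)

lemma Omega_sym: "transpose_mat (Omega d) = Omega d"
  unfolding Omega_def
  by (rule transpose_minus_sym[OF Phi_props(1) Psi_props(1) pos_def_sym pos_def_sym])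
    (rule Phi_props Psi_props)+

text \<open>\<open>Phi\<close> and \<open>Psi\<close> are block diagonal in time, hence so is
  \<open>Omega\<close>, and the claim reduces to the reflection at each time step.\<close>

lemma Phi_add_Omega_pos_def: "pos_def (Phi d + Omega d)"
proof -
  let ?H = "\<lambda>t. Phi_hat d t + (Phi_hat d t - Psi_hat d t)"
  have H: "?H t \<in> carrier_mat nh nh" "pos_def (?H t)" if "t < gT d + 1" for t
    using Psi_hat_props(1)[of t] Phi_hat_reflection_pos_def[of t] that
    by (auto intro: add_carrier_mat minus_carrier_mat)
  note car = Phi_props(1)[unfolded n_total_eq] Psi_props(1)[unfolded n_total_eq] Omega_carrier[unfolded n_total_eq]
  have "Phi d + Omega d = blkdiag (gT d + 1) ?H"
  proof (rule sub_mat_eqI[of _ nh "gT d + 1"])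
    show "Phi d + Omega d \<in> carrier_mat (nh * (gT d + 1)) (nh * (gT d + 1))"
      using car(3) by (rule add_carrier_mat)
    show "blkdiag (gT d + 1) ?H \<in> carrier_mat (nh * (gT d + 1)) (nh * (gT d + 1))"
      unfolding offset_const[symmetric] by (rule blkdiag_carrier) (rule H(1))
    fix a b assume ab: "a < gT d + 1" "b < gT d + 1"
    have "sub_mat nh (Phi d + Omega d) a b =
        sub_mat nh (Phi d) a b + (sub_mat nh (Phi d) a b - sub_mat nh (Psi d) a b)"
      using sub_mat_add[OF car(1,3) ab] sub_mat_minus[OF car(1,2) ab] by (simp add: Omega_def)
    moreover have "sub_mat nh (Phi d) a b = (if a = b then Phi_hat d a else 0\<^sub>m nh nh)"
      unfolding Phi_def by (rule sub_mat_blkdiag[OF Phi_hat_carrier ab])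
    moreover have "sub_mat nh (Psi d) a b = (if a = b then Psi_hat d a else 0\<^sub>m nh nh)"
      unfolding Psi_def by (rule sub_mat_blkdiag[OF _ ab]) (simp add: Psi_hat_props)
    moreover have "sub_mat nh (blkdiag (gT d + 1) ?H) a b = (if a = b then ?H a else 0\<^sub>m nh nh)"
      by (rule sub_mat_blkdiag[OF H(1) ab])
    ultimately show "sub_mat nh (Phi d + Omega d) a b = sub_mat nh (blkdiag (gT d + 1) ?H) a b"
      by (cases "a = b") (auto intro!: eq_matI)
  qed
  moreover have "pos_def (blkdiag (gT d + 1) ?H)"
    by (rule pos_def_blkdiag) (rule H; assumption)+
  ultimately show ?thesis by simp
qed

section \<open>The matrix \<open>Delta\<close> and the outer splitting\<close>

abbreviation "AQ t \<equiv> A_hat d t * minv (Q_hat d t)"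

lemma AQ_carrier: "t \<le> gT d \<Longrightarrow> AQ t \<in> carrier_mat nh nh"
  using A_hat_props(1) Q_inv_props(1) by (rule mult_carrier_mat)

lemma Delta_carrier: "Delta d \<in> carrier_mat (n_total d) (n_total d)"
  unfolding Delta_def n_total_eq offset_const[symmetric] by (rule block_tridiag_carrier)

lemma sub_mat_Delta:
  assumes ab: "a < gT d + 1" "b < gT d + 1"
  shows "sub_mat nh (Delta d) a b = (if b = a then Psi_hat d a
    else if b = Suc a then transpose_mat (- AQ a)
    else if a = Suc b then - AQ b else 0\<^sub>m nh nh)"
proof -
  \<comment> \<open>\<open>Delta\<close> numbers a lower block by its row, hence
    \<open>a - 1\<close>; where \<open>a = Suc b\<close> this is \<open>b\<close>.\<close>
  have "sub_mat nh (Delta d) a b = (if b = a then Psi_hat d a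
    else if b = Suc a then transpose_mat (- AQ a)
    else if a = Suc b then - AQ (a - 1) else 0\<^sub>m nh nh)"
    unfolding Delta_def
    by (rule sub_mat_block_tridiag[OF ab])
      (use ab Psi_hat_props(1)[of a] AQ_carrier[of a] AQ_carrier[of "a - 1"] in auto)
  then show ?thesis by auto
qed

lemma Delta_sym: "transpose_mat (Delta d) = Delta d"
proof (rule sub_mat_eqI[of _ nh "gT d + 1"])
  note car = Delta_carrier[unfolded n_total_eq]
  show "Delta d \<in> carrier_mat (nh * (gT d + 1)) (nh * (gT d + 1))" by (rule car)
  show "transpose_mat (Delta d) \<in> carrier_mat (nh * (gT d + 1)) (nh * (gT d + 1))"
    using car by simp
  fix a b assume ab: "a < gT d + 1" "b < gT d + 1"
  then show "sub_mat nh (transpose_mat (Delta d)) a b = sub_mat nh (Delta d) a b"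
    unfolding sub_mat_transpose[OF car ab] sub_mat_Delta[OF ab] sub_mat_Delta[OF ab(2,1)]
    using pos_def_sym[OF Psi_hat_props(2)[of a]] by auto
qed

lemma Xi_carrier: "Xi d \<in> carrier_mat (n_total d) (n_total d)"
  unfolding Xi_def using Delta_carrier by (rule minus_carrier_mat)

lemma Xi_sym: "transpose_mat (Xi d) = Xi d"
  unfolding Xi_def
  by (rule transpose_minus_sym[OF Psi_props(1) Delta_carrier pos_def_sym[OF Psi_props(2)] Delta_sym])

text \<open>The sum is \<open>2 Psi - Delta\<close>. As \<open>Psi\<close> is the block diagonal of
  \<open>Delta\<close>, this is \<open>Delta\<close> with its off-diagonal blocks negated.\<close>

lemma sub_mat_Psi_add_Xi:
  assumes ab: "a < gT d + 1" "b < gT d + 1"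
  shows "sub_mat nh (Psi d + Xi d) a b = (if b = a then Psi_hat d a
    else if b = Suc a then transpose_mat (AQ a)
    else if a = Suc b then AQ b else 0\<^sub>m nh nh)"
proof -
  note car = Psi_props(1)[unfolded n_total_eq] Delta_carrier[unfolded n_total_eq] Xi_carrier[unfolded n_total_eq]
  have neg: "0\<^sub>m nh nh + (0\<^sub>m nh nh - - X) = X" and neg': "0\<^sub>m nh nh + (0\<^sub>m nh nh - transpose_mat (- X)) = transpose_mat X"
    and diag: "X + (X - X) = X" and "0\<^sub>m nh nh + (0\<^sub>m nh nh - 0\<^sub>m nh nh) = (0\<^sub>m nh nh :: real mat)"
    if "X \<in> carrier_mat nh nh" for X :: "real mat"
    using carrier_matD[OF that] by (intro eq_matI; simp)+
  have "sub_mat nh (Psi d + Xi d) a b =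
      sub_mat nh (Psi d) a b + (sub_mat nh (Psi d) a b - sub_mat nh (Delta d) a b)"
    using sub_mat_add[OF car(1,3) ab] sub_mat_minus[OF car(1,2) ab] by (simp add: Xi_def)
  moreover have "sub_mat nh (Psi d) a b = (if a = b then Psi_hat d a else 0\<^sub>m nh nh)"
    unfolding Psi_def by (rule sub_mat_blkdiag[OF _ ab]) (simp add: Psi_hat_props)
  moreover have "Psi_hat d a \<in> carrier_mat nh nh" "AQ a \<in> carrier_mat nh nh" "AQ b \<in> carrier_mat nh nh"
    using ab Psi_hat_props(1)[of a] AQ_carrier by simp_all
  ultimately show ?thesis
    unfolding sub_mat_Delta[OF ab] by (auto simp: neg neg' diag)
qed

text \<open>Completing squares: the quadratic form is the sum over \<open>t\<close> of the \<open>Q_t\<^sup>-\<^sup>1\<close>-norms of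
  \<open>v_t + A_t' v_(t+1)\<close> and of the nonnegative terms that come from \<open>B_t\<close>.\<close>

lemma Psi_add_Xi_pos_def: "pos_def (Psi d + Xi d)"
proof (rule pos_defI)
  show car: "Psi d + Xi d \<in> carrier_mat (n_total d) (n_total d)"
    using Xi_carrier by (rule add_carrier_mat)
  show "transpose_mat (Psi d + Xi d) = Psi d + Xi d"
    using transpose_add[OF Psi_props(1) Xi_carrier] pos_def_sym[OF Psi_props(2)] Xi_sym by simp
  fix v :: "real vec" assume v: "v \<in> carrier_vec (n_total d)" "v \<noteq> 0\<^sub>v (n_total d)"
  define x where "x t = sub_vec nh v t" for t
  define y where "y t = transpose_mat (A_hat d t) *\<^sub>v x (Suc t)" for t
  define z where "z t = transpose_mat (B_hat d t) *\<^sub>v x (Suc t)" for t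
  define q where "q t u = u \<bullet> (minv (Q_hat d t) *\<^sub>v u)" for t u
  define c where "c t = z t \<bullet> (minv (R_hat d t) *\<^sub>v z t)" for t
  \<comment> \<open>Set to 0 outside the index range because \<open>sum_tridiag\<close> asks for the
    tri-diagonal pattern at all indices.\<close>
  define g where "g a b = (if a < gT d + 1 \<and> b < gT d + 1
    then x a \<bullet> (sub_mat nh (Psi d + Xi d) a b *\<^sub>v x b) else 0)" for a b
  have x: "x t \<in> carrier_vec nh" for t by (simp add: x_def)
  have y: "y t \<in> carrier_vec nh" for t unfolding y_def using A_hat_props(1)[of t] x by simp
  have z: "z t \<in> carrier_vec mh" if "t < gT d" for t
    unfolding z_def using B_hat_props(1)[OF that] x by simp
  have c_nonneg: "0 \<le> c t" if "t < gT d" for t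
    unfolding c_def using R_inv_props[OF that] z[OF that] by (intro pos_def_quad_nonneg) auto
  have q_nonneg: "0 \<le> q t u" if "t \<le> gT d" "u \<in> carrier_vec nh" for t u
    unfolding q_def using Q_inv_props[OF that(1)] that(2) by (intro pos_def_quad_nonneg) auto
  have q_0: "u = 0\<^sub>v nh" if "t \<le> gT d" "u \<in> carrier_vec nh" "q t u \<le> 0" for t u
    using pos_def_quad_eq_0[OF Q_inv_props(2,1)[OF that(1)] that(2)] that(3) by (simp add: q_def)
  have diag_0: "g 0 0 = q 0 (x 0)"
    using sub_mat_Psi_add_Xi[of 0 0] by (simp add: g_def q_def)
  have diag_Suc: "g (Suc t) (Suc t) = q (Suc t) (x (Suc t)) + q t (y t) + c t" if "t < gT d" for t
    using sub_mat_Psi_add_Xi[of "Suc t" "Suc t"] quad_Psi_hat_Suc[OF that x[of "Suc t"]] that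
    by (simp add: g_def q_def c_def y_def z_def)
  \<comment> \<open>The two off-diagonal blocks are transposes of each other, so both contribute the
    same cross term.\<close>
  have off: "g t (Suc t) + g (Suc t) t = 2 * (y t \<bullet> (minv (Q_hat d t) *\<^sub>v x t))" if t: "t < gT d" for t
  proof -
    note AQ = AQ_carrier[of t] and Q = Q_inv_props(1)[of t] and A = A_hat_props(1)[of t]
    have Qx: "minv (Q_hat d t) *\<^sub>v x t \<in> carrier_vec nh" using Q t x by simp
    have AQx: "AQ t *\<^sub>v x t = A_hat d t *\<^sub>v (minv (Q_hat d t) *\<^sub>v x t)"
      using A Q t x by (simp add: assoc_mult_mat_vec[of _ nh nh _ nh])
    have 1: "g (Suc t) t = y t \<bullet> (minv (Q_hat d t) *\<^sub>v x t)"
      using sub_mat_Psi_add_Xi[of "Suc t" t] t scalar_prod_mult_mat_vec_left[OF A x Qx]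
      by (simp add: g_def y_def AQx)
    have "g t (Suc t) = x t \<bullet> (transpose_mat (AQ t) *\<^sub>v x (Suc t))"
      using sub_mat_Psi_add_Xi[of t "Suc t"] t by (simp add: g_def)
    also have "\<dots> = (AQ t *\<^sub>v x t) \<bullet> x (Suc t)"
      using scalar_prod_mult_mat_vec_left[OF _ x x, of "transpose_mat (AQ t)" t "Suc t"] AQ t by simp
    also have "\<dots> = x (Suc t) \<bullet> (AQ t *\<^sub>v x t)"
      by (rule comm_scalar_prod[of _ nh]) (use AQ t x in auto)
    also have "\<dots> = g (Suc t) t"
      using sub_mat_Psi_add_Xi[of "Suc t" t] t by (simp add: g_def)
    finally show ?thesis using 1 by simp
  qed
  have tri: "g a b = 0" if "Suc a < b \<or> Suc b < a" for a b
  proof -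
    have "0\<^sub>m nh nh *\<^sub>v x b = 0\<^sub>v nh" using x by (intro eq_vecI) auto
    then show ?thesis using that sub_mat_Psi_add_Xi[of a b] x by (auto simp: g_def)
  qed
  have "v \<bullet> ((Psi d + Xi d) *\<^sub>v v) = (\<Sum>a<Suc (gT d). \<Sum>b<Suc (gT d). g a b)"
    using quad_blocks[OF car[unfolded n_total_eq] v(1)[unfolded n_total_eq]] by (simp add: g_def x_def)
  also have "\<dots> = (\<Sum>a<Suc (gT d). g a a) + (\<Sum>t<gT d. g t (Suc t) + g (Suc t) t)"
    by (rule sum_tridiag) (auto simp: tri)
  also have "(\<Sum>a<Suc (gT d). g a a) = q 0 (x 0) + (\<Sum>t<gT d. q (Suc t) (x (Suc t)) + (q t (y t) + c t))"
    unfolding sum.lessThan_Suc_shift diag_0 by (simp add: diag_Suc add.assoc)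
  also have "\<dots> = (\<Sum>t<Suc (gT d). q t (x t)) + (\<Sum>t<gT d. q t (y t) + c t)"
    unfolding sum.lessThan_Suc_shift[of "\<lambda>t. q t (x t)"] sum.distrib by simp
  \<comment> \<open>The norms of \<open>x t\<close> with \<open>t\<close> below the horizon join the
    terms in \<open>y t\<close> and the cross terms; the norm at the final time is left
    over.\<close>
  also have "\<dots> + (\<Sum>t<gT d. g t (Suc t) + g (Suc t) t)
      = q (gT d) (x (gT d)) + (\<Sum>t<gT d. q t (x t) + 2 * (y t \<bullet> (minv (Q_hat d t) *\<^sub>v x t)) + q t (y t) + c t)"
    by (simp add: off sum.distrib)
  also have "\<dots> = q (gT d) (x (gT d)) + (\<Sum>t<gT d. q t (x t + y t) + c t)"
    using quad_square[OF Q_inv_props(1) pos_def_sym[OF Q_inv_props(2)] x y] by (simp add: q_def)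
  finally have quad: "v \<bullet> ((Psi d + Xi d) *\<^sub>v v) = q (gT d) (x (gT d)) + (\<Sum>t<gT d. q t (x t + y t) + c t)" .
  have term_nonneg: "0 \<le> q t (x t + y t) + c t" if "t < gT d" for t
    using q_nonneg[of t "x t + y t"] c_nonneg[OF that] that x y by simp
  show "0 < v \<bullet> ((Psi d + Xi d) *\<^sub>v v)"
  proof (rule ccontr)
    assume "\<not> ?thesis"
    then have le: "q (gT d) (x (gT d)) + (\<Sum>t<gT d. q t (x t + y t) + c t) \<le> 0"
      by (simp add: quad)
    have s: "0 \<le> (\<Sum>t<gT d. q t (x t + y t) + c t)"
      using term_nonneg by (intro sum_nonneg) simp
    have last: "x (gT d) = 0\<^sub>v nh"
      using q_0[OF _ x, of "gT d" "gT d"] le s by simp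
    have "(\<Sum>t<gT d. q t (x t + y t) + c t) = 0"
      using le s q_nonneg[OF _ x, of "gT d" "gT d"] by simp
    then have z0: "q t (x t + y t) + c t = 0" if "t < gT d" for t
      using sum_nonneg_eq_0_iff[of "{..<gT d}" "\<lambda>t. q t (x t + y t) + c t"] term_nonneg that by simp
    \<comment> \<open>Backward in time: once \<open>x (Suc t)\<close> vanishes so does
      \<open>y t\<close>, and the vanishing square leaves \<open>x t = 0\<close>. The leftover norm
      starts this at the final time.\<close>
    have step: "x t = 0\<^sub>v nh" if t: "t < gT d" and "x (Suc t) = 0\<^sub>v nh" for t
    proof -
      have "x t + y t = 0\<^sub>v nh"
        using q_0[of t "x t + y t"] z0[OF t] c_nonneg[OF t] t x y by simp
      moreover have "y t = 0\<^sub>v nh"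
        unfolding y_def that(2) using A_hat_props(1)[of t] by (intro eq_vecI) auto
      ultimately show ?thesis using x by simp
    qed
    have "x t = 0\<^sub>v nh" if "t \<le> gT d" for t
      using that by (induction t rule: inc_induct) (auto simp: last step)
    then have "v = 0\<^sub>v (nh * (gT d + 1))"
      using v(1) by (intro sub_vec_eq_0) (auto simp: n_total_eq x_def)
    with v(2) show False by (simp add: n_total_eq)
  qed
qed

section \<open>The iterates as partial sums applied to the right-hand side\<close>

text \<open>Invertibility of \<open>Phi\<close> gives the unique existence that the
  \<open>THE\<close> in \<open>lin_solution\<close> relies on.\<close>

lemma lin_solution_Phi:
  assumes b: "b \<in> carrier_vec (n_total d)"
  shows "lin_solution (Phi d) b = minv (Phi d) *\<^sub>v b"
  unfolding lin_solution_def
proof (rule the_equality)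
  note F = Phi_props(1) and I = minv_carrier[OF Phi_props(2,1)]
    minv_right[OF Phi_props(2,1)] minv_left[OF Phi_props(2,1)]
  show "minv (Phi d) *\<^sub>v b \<in> carrier_vec (dim_col (Phi d)) \<and> Phi d *\<^sub>v (minv (Phi d) *\<^sub>v b) = b"
    using assoc_mult_mat_vec[OF F I(1) b] I F b by simp
  fix x assume "x \<in> carrier_vec (dim_col (Phi d)) \<and> Phi d *\<^sub>v x = b"
  then show "x = minv (Phi d) *\<^sub>v b"
    using assoc_mult_mat_vec[OF I(1) F, of x] I F by auto
qed

text \<open>The starting value 0 matches the empty sum, and each solve matches
  \<open>partial_sum_rec_vec\<close> for \<open>minv (Phi d)\<close> and
  \<open>Omega d\<close>.\<close>

lemma inner_iterate_eq:
  assumes b: "b \<in> carrier_vec (n_total d)"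
  shows "inner_iterate d b l = Upsilon d l *\<^sub>v b"
proof (induction l)
  case 0
  then show ?case using b by (simp add: Upsilon_def mat_sum_0 zero_mult_vec)
next
  case (Suc l)
  note P = minv_carrier[OF Phi_props(2,1)] pos_def_sym[OF pos_def_minv_pos_def[OF Phi_props(2,1)]]
  have "Upsilon d l *\<^sub>v b \<in> carrier_vec (n_total d)"
    unfolding Upsilon_def using b by (rule mult_mat_vec_carrier[OF mat_sum_carrier])
  then have "b + Omega d *\<^sub>v (Upsilon d l *\<^sub>v b) \<in> carrier_vec (n_total d)"
    using b Omega_carrier by simp
  then show ?case
    using Suc partial_sum_rec_vec[OF P(1) Omega_carrier P(2) Omega_sym b, of l]
    by (simp add: lin_solution_Phi Upsilon_def)
qed

text \<open>By \<open>inner_iterate_eq\<close>, an outer step multiplies its right-hand side by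
  \<open>Upsilon d L\<close>, so the same recursion applies with \<open>Xi d\<close>. Positivity of
  \<open>Upsilon d L\<close> supplies its symmetry.\<close>

lemma nested_jacobi_eq:
  assumes r: "r \<in> carrier_vec (n_total d)" and "pos_def (Upsilon d L)"
  shows "nested_jacobi d L r s = varDelta d L s *\<^sub>v r"
proof (induction s)
  case 0
  then show ?case using r by (simp add: varDelta_def mat_sum_0 zero_mult_vec)
next
  case (Suc s)
  have U: "Upsilon d L \<in> carrier_mat (n_total d) (n_total d)" by (simp add: Upsilon_def)
  have "varDelta d L s *\<^sub>v r \<in> carrier_vec (n_total d)"
    unfolding varDelta_def using r by (rule mult_mat_vec_carrier[OF mat_sum_carrier])
  then have "r + Xi d *\<^sub>v (varDelta d L s *\<^sub>v r) \<in> carrier_vec (n_total d)"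
    using r Xi_carrier by simp
  then show ?case
    using Suc partial_sum_rec_vec[OF U Xi_carrier pos_def_sym[OF assms(2)] Xi_sym r, of s]
    by (simp add: inner_iterate_eq varDelta_def)
qed

lemma varDelta_pos_def:
  assumes "even L" "1 \<le> L" "1 \<le> S"
  shows "pos_def (Upsilon d L)" "pos_def (varDelta d L S)"
proof -
  have "Phi d - Omega d = Psi d"
    unfolding Omega_def using carrier_matD[OF Phi_props(1)] carrier_matD[OF Psi_props(1)]
    by (intro eq_matI) simp_all
  then have "pos_def (Phi d - Omega d + Xi d)" using Psi_add_Xi_pos_def by simp
  from nested_partial_sum_pos_def[OF Phi_props Omega_carrier Omega_sym Phi_add_Omega_pos_def
    Xi_carrier Xi_sym this assms]
  show "pos_def (Upsilon d L)" "pos_def (varDelta d L S)"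
    unfolding varDelta_def Upsilon_def .
qed

end

theorem theorem3:
  fixes d :: lq_data and S L :: nat
  assumes "lq_problem d"
    and "S \<ge> 1"
    and "even L" and "L \<ge> 2"
  shows "invertible_mat (varDelta d L S) \<and>
         pos_def (minv (varDelta d L S)) \<and>
         (\<forall>r \<in> carrier_vec (n_total d).
            minv (varDelta d L S) *\<^sub>v nested_jacobi d L r S = r)"
proof (intro conjI ballI)
  let ?V = "varDelta d L S"
  have V: "?V \<in> carrier_mat (n_total d) (n_total d)" by (simp add: varDelta_def)
  have pd: "pos_def (Upsilon d L)" "pos_def ?V"
    using varDelta_pos_def[OF assms(1,3) _ assms(2)] assms(4) by simp_all
  show "invertible_mat ?V" using pos_def_invertible[OF pd(2) V] .
  show "pos_def (minv ?V)" using pos_def_minv_pos_def[OF pd(2) V] .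
  fix r :: "real vec" assume r: "r \<in> carrier_vec (n_total d)"
  \<comment> \<open>The iterate is \<open>?V\<close> applied to \<open>r\<close>, so the inverse of
    \<open>?V\<close> recovers \<open>r\<close>.\<close>
  show "minv ?V *\<^sub>v nested_jacobi d L r S = r"
    unfolding nested_jacobi_eq[OF assms(1) r pd(1)]
    using assoc_mult_mat_vec[OF minv_carrier[OF pd(2) V] V r] minv_left[OF pd(2) V] r by simp
qed

end
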